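(* Let $s\geq 3$ be a fixed integer and let $p=p(n)\in[0,1]$ satisfy $p(n)\geq n^{-1/(2s-3)}\ln n$ for all sufficiently large $n$. Then, whp, $\mathbb{G}(n,p)$ has the property $\mathcal{A}_s$; that is, $$\mathbb{P}\left[\mathrm{wsat}\big(\mathbb{G}(n,p),K_s\big)=\binom{s-2}{2}+(s-2)(n-s+2)\right]\to 1\quad\text{as } n\to\infty.$$
   Context: All graphs are finite and simple. $K_s$ is the complete graph on $s$ vertices. Given a graph $F$, an $F$-bootstrap percolation process is a sequence of graphs $H_0\subset H_1\subset\cdots\subset H_m$ (on the same vertex set) such that, for $i=1,\ldots,m$, $H_i$ is obtained from $H_{i-1}$ by adding an edge that belongs to a copy of $F$ in $H_i$. Given graphs $G$ and $F$, a spanning subgraph $H$ of $G$ is a weakly $F$-saturated subgraph of $G$ if $H$ contains no subgraph isomorphic to $F$ and there is an $F$-bootstrap percolation process $H=H_0\subset H_1\subset\cdots\subset H_m=G$. The minimum number of edges in a weakly $F$-saturated subgraph of $G$ is denoted by $\mathrm{wsat}(G,F)$. $\mathbb{G}(n,p)$ is the Erdős–Rényi random graph on vertex set $\{1,\ldots,n\}$ in which each pair of distinct vertices is an edge with probability $p$ independently of all others. $\mathcal{A}_s$ is the property of an $n$-vertex graph $G$ that $\mathrm{wsat}(G,K_s)=\binom{s-2}{2}+(s-2)(n-s+2)$. "Whp" (with high probability) means with probability tending to $1$ as $n\to\infty$. *)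

theory Defs
  imports "HOL-Probability.Probability" "HOL-Library.Ramsey"
begin

text \<open>
  A graph is a pair of a vertex set and an edge set; edges are two-element sets of
  vertices, as given by \<^term>\<open>nsets V 2\<close>.
\<close>

type_synonym 'a graph = "'a set \<times> 'a set set"

abbreviation verts :: "'a graph \<Rightarrow> 'a set" where
  "verts G \<equiv> fst G"

abbreviation edges :: "'a graph \<Rightarrow> 'a set set" where
  "edges G \<equiv> snd G"

definition simple_graph :: "'a graph \<Rightarrow> bool" where
  "simple_graph G \<longleftrightarrow> finite (verts G) \<and> edges G \<subseteq> nsets (verts G) 2"

definition subgraph :: "'a graph \<Rightarrow> 'a graph \<Rightarrow> bool" where
  "subgraph H G \<longleftrightarrow>
     simple_graph H \<and> simple_graph G \<and> verts H \<subseteq> verts G \<and> edges H \<subseteq> edges G"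

definition spanning_subgraph :: "'a graph \<Rightarrow> 'a graph \<Rightarrow> bool" where
  "spanning_subgraph H G \<longleftrightarrow> subgraph H G \<and> verts H = verts G"

definition isomorphic :: "'a graph \<Rightarrow> 'b graph \<Rightarrow> bool" where
  "isomorphic G H \<longleftrightarrow>
     (\<exists>f. bij_betw f (verts G) (verts H) \<and> (\<lambda>e. f ` e) ` edges G = edges H)"

definition copy_of :: "'b graph \<Rightarrow> 'a graph \<Rightarrow> 'a graph \<Rightarrow> bool" where
  "copy_of F G C \<longleftrightarrow> subgraph C G \<and> isomorphic F C"

definition complete_graph :: "nat \<Rightarrow> nat graph" where
  "complete_graph s = ({1..s}, nsets {1..s} 2)"

definition bootstrap_process :: "'b graph \<Rightarrow> (nat \<Rightarrow> 'a graph) \<Rightarrow> nat \<Rightarrow> bool" where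
  "bootstrap_process F H m \<longleftrightarrow>
     (\<forall>i\<le>m. simple_graph (H i)) \<and>
     (\<forall>i\<in>{1..m}. \<exists>e. e \<notin> edges (H (i - 1)) \<and>
        H i = (verts (H (i - 1)), insert e (edges (H (i - 1)))) \<and>
        (\<exists>C. copy_of F (H i) C \<and> e \<in> edges C))"

definition weakly_saturated :: "'a graph \<Rightarrow> 'b graph \<Rightarrow> 'a graph \<Rightarrow> bool" where
  "weakly_saturated G F H \<longleftrightarrow>
     spanning_subgraph H G \<and>
     \<not> (\<exists>C. copy_of F H C) \<and>
     (\<exists>m P. bootstrap_process F P m \<and> P 0 = H \<and> P m = G)"

text \<open>
  If \<open>F\<close> has at least one edge, the minimum exists: deleting an edge of a copy of \<open>F\<close>
  from \<open>G\<close>, as long as there is such a copy, ends in a weakly \<open>F\<close>-saturated subgraph.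
\<close>

definition wsat :: "'a graph \<Rightarrow> 'b graph \<Rightarrow> nat" where
  "wsat G F = (LEAST k. \<exists>H. weakly_saturated G F H \<and> card (edges H) = k)"

text \<open>The equation is stated over the integers, so that \<open>n - s + 2\<close> is not truncated.\<close>

definition property_A :: "nat \<Rightarrow> 'a graph \<Rightarrow> bool" where
  "property_A s G \<longleftrightarrow>
     int (wsat G (complete_graph s)) =
       int ((s - 2) choose 2) + (int s - 2) * (int (card (verts G)) - int s + 2)"

text \<open>
  The random function of type \<^typ>\<open>nat set \<Rightarrow> bool\<close> consists of independent
  coin flips, one for each pair of distinct vertices, telling whether that pair is an edge.
  Note that \<^const>\<open>bernoulli_pmf\<close> is only meaningful for parameters between 0 and 1.
\<close>

definition gnp :: "nat \<Rightarrow> real \<Rightarrow> nat graph pmf" where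
  "gnp n p =
     map_pmf (\<lambda>c. ({1..n}, {e \<in> nsets {1..n} 2. c e}))
       (Pi_pmf (nsets {1..n} 2) False (\<lambda>_. bernoulli_pmf p))"

end

theory Submission
  imports Defs "HOL-Computational_Algebra.Polynomial" "HOL-Real_Asymp.Real_Asymp"
begin

text \<open>
  Write \<open>d = s - 2\<close>.

  Lower bound. For polynomials \<open>f\<^sub>1, \<dots>, f\<^sub>n\<close> of degree less than \<open>d\<close>, an edge function
  \<open>f\<^sub>i(j) - f\<^sub>j(i)\<close> that vanishes on all edges of a \<open>K\<^sub>s\<close> but one also vanishes on the last one,
  by Lagrange interpolation at the \<open>d\<close> remaining vertices. So an edge function vanishing on a
  percolating \<open>H\<close> vanishes on \<open>G\<close>, and then on the complete graph, as any two vertices have a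
  \<open>d\<close>-clique in their common neighbourhood. Hence \<open>H\<close> has at least as many edges as the dimension
  \<open>d n - d (d + 1) / 2\<close> of the space of these functions.

  Upper bound, by induction on \<open>s\<close>. Take all edges at a vertex \<open>r\<close>, a subgraph of \<open>N(r)\<close> that is
  percolating for \<open>K\<^bsub>s-1\<^esub>\<close>, and for every other vertex \<open>v\<close> the edges to a \<open>d\<close>-clique in
  \<open>N(r) \<inter> N(v)\<close>. The latter spread to all edges from \<open>v\<close> to \<open>N(r)\<close> if any \<open>s + 1\<close> vertices have
  a common neighbour, which holds whp for \<open>s \<ge> 4\<close>, since then \<open>s + 1 \<le> 2 s - 3\<close>. For \<open>s = 3\<close> only
  any three vertices have a common neighbour, but all the graphs induced on \<open>N(r) \<inter> N(v)\<close> are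
  connected whp, which suffices.
\<close>

section \<open>Percolation\<close>

text \<open>The state reached by greedy percolation inside the host edge set \<open>E\<close>. An
  added edge never blocks a later one, so the order of additions is irrelevant and a closure
  operator can replace sequences of graphs.\<close>

inductive_set percolated :: "nat \<Rightarrow> 'a set set \<Rightarrow> 'a set set \<Rightarrow> 'a set set" for s E H where
  init: "e \<in> H \<Longrightarrow> e \<in> percolated s E H"
| step: "finite K \<Longrightarrow> card K = s \<Longrightarrow> nsets K 2 \<subseteq> E \<Longrightarrow> e \<in> nsets K 2 \<Longrightarrow>
    (\<And>f. f \<in> nsets K 2 \<Longrightarrow> f \<noteq> e \<Longrightarrow> f \<in> percolated s E H) \<Longrightarrow> e \<in> percolated s E H"

lemma percolated_closed:
  assumes "H \<subseteq> percolated s E H'"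
  shows "percolated s E H \<subseteq> percolated s E H'"
proof
  fix e assume "e \<in> percolated s E H"
  then show "e \<in> percolated s E H'"
  proof induction
    case (init e) then show ?case using assms by auto
  next
    case (step K e) then show ?case by (metis percolated.step)
  qed
qed

lemma percolated_mono: "H \<subseteq> H' \<Longrightarrow> percolated s E H \<subseteq> percolated s E H'"
  by (rule percolated_closed) (auto intro: percolated.init)

text \<open>A bijection of vertex sets carries all pairs to all pairs, so a copy of K_s is
  determined by its vertex set. From here on cliques are handled as sets \<open>K\<close>.\<close>

lemma copy_of_complete_graph_iff:
  assumes "simple_graph G"
  shows "copy_of (complete_graph s) G C \<longleftrightarrow>
    (\<exists>K. K \<subseteq> verts G \<and> card K = s \<and> finite K \<and> nsets K 2 \<subseteq> edges G \<and> C = (K, nsets K 2))"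
proof
  assume "copy_of (complete_graph s) G C"
  then have sub: "subgraph C G" and iso: "isomorphic (complete_graph s) C"
    by (auto simp: copy_of_def)
  from iso obtain f where f: "bij_betw f {1..s} (verts C)"
    and e: "(\<lambda>e. f ` e) ` nsets {1..s} 2 = edges C"
    by (auto simp: isomorphic_def complete_graph_def)
  have fin: "finite (verts C)" using f bij_betw_finite by blast
  have "card (verts C) = s" using bij_betw_same_card[OF f] by simp
  moreover have "edges C = nsets (verts C) 2"
    using bij_betw_nsets[OF f, of 2] e by (simp add: bij_betw_def)
  ultimately show "\<exists>K. K \<subseteq> verts G \<and> card K = s \<and> finite K \<and> nsets K 2 \<subseteq> edges G \<and> C = (K, nsets K 2)"
    using sub fin by (intro exI[of _ "verts C"]) (auto simp: subgraph_def prod_eq_iff)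
next
  assume "\<exists>K. K \<subseteq> verts G \<and> card K = s \<and> finite K \<and> nsets K 2 \<subseteq> edges G \<and> C = (K, nsets K 2)"
  then obtain K where K: "K \<subseteq> verts G" "card K = s" "finite K" "nsets K 2 \<subseteq> edges G"
    "C = (K, nsets K 2)" by blast
  obtain f where f: "bij_betw f {1..s} K"
    using finite_same_card_bij[of "{1..s}" K] K by auto
  have "isomorphic (complete_graph s) C"
    unfolding isomorphic_def complete_graph_def
    using f bij_betw_nsets[OF f, of 2] K(5) by (auto simp: bij_betw_def)
  then show "copy_of (complete_graph s) G C"
    using K assms by (auto simp: copy_of_def subgraph_def simple_graph_def)
qed

lemma percolated_subset:
  assumes "H \<subseteq> E" shows "percolated s E H \<subseteq> E"
proof
  fix e assume "e \<in> percolated s E H"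
  then show "e \<in> E" by induction (use assms in auto)
qed

text \<open>If no single edge could be added, \<open>H\<close> would be closed under the percolation
  rule and hence contain \<open>E\<close>. Otherwise one edge is added, induction on the number of
  missing edges gives a process for the enlarged graph, and \<open>Q\<close> puts \<open>H\<close>
  in front of it.\<close>

lemma percolated_imp_bootstrap_process:
  assumes "simple_graph (V, E)" "H \<subseteq> E" "E \<subseteq> percolated s E H"
  shows "\<exists>m P. bootstrap_process (complete_graph s) P m \<and> P 0 = (V, H) \<and> P m = (V, E)"
  using assms(2,3)
proof (induction "card (E - H)" arbitrary: H rule: less_induct)
  case less
  have finE: "finite E"
    using assms(1) by (auto simp: simple_graph_def intro: finite_subset finite_imp_finite_nsets)
  have simp_sub: "simple_graph (V, F)" if "F \<subseteq> E" for F
    using that assms(1) by (auto simp: simple_graph_def)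
  show ?case
  proof (cases "H = E")
    case True
    then show ?thesis using assms(1)
      by (intro exI[of _ 0] exI[of _ "\<lambda>_. (V, E)"]) (auto simp: bootstrap_process_def)
  next
    case False
    have "\<exists>K e. finite K \<and> card K = s \<and> nsets K 2 \<subseteq> E \<and> e \<in> nsets K 2 \<and>
       nsets K 2 - {e} \<subseteq> H \<and> e \<notin> H"
    proof (rule ccontr)
      assume *: "\<not> ?thesis"
      have "e \<in> H" if "e \<in> percolated s E H" for e
        using that
      proof induction
        case (step K e)
        then show ?case using * by (metis DiffD1 DiffD2 insertI1 subsetI)
      qed
      then show False using False less.prems by auto
    qed
    then obtain K e where K: "finite K" "card K = s" "nsets K 2 \<subseteq> E" "e \<in> nsets K 2"
       "nsets K 2 - {e} \<subseteq> H" "e \<notin> H" by blast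
    have eE: "e \<in> E" using K by auto
    have "card (E - insert e H) < card (E - H)"
      using eE K(6) finE by (intro psubset_card_mono) auto
    moreover have "E \<subseteq> percolated s E (insert e H)"
      using less.prems(2) percolated_mono[of H "insert e H" s E] by blast
    ultimately obtain m P where P: "bootstrap_process (complete_graph s) P m"
      "P 0 = (V, insert e H)" "P m = (V, E)"
      using less.hyps[of "insert e H"] eE less.prems(1) by blast
    define Q where "Q i = (if i = 0 then (V, H) else P (i - 1))" for i
    \<comment> \<open>A vertex of \<open>K\<close> lies in \<open>V\<close> because it is an end of
      an edge; the edge \<open>e\<close> inside \<open>K\<close> guarantees that there is a second
      vertex.\<close>
    have KV: "K \<subseteq> V"
    proof
      fix x assume "x \<in> K"
      have "card K \<ge> 2"
        using K(1,4) card_mono[of K e] by (auto simp: nsets_def)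
      then have "\<exists>y\<in>K. y \<noteq> x"
        using \<open>x \<in> K\<close> K(1) by (metis card_le_Suc0_iff_eq not_less_eq_eq numeral_2_eq_2)
      then obtain y where "y \<in> K" "y \<noteq> x" by blast
      then have "{x, y} \<in> nsets K 2" using \<open>x \<in> K\<close> by simp
      moreover have "E \<subseteq> nsets V 2" using assms(1) by (simp add: simple_graph_def)
      ultimately have "{x, y} \<in> nsets V 2" using K(3) by blast
      then show "x \<in> V" by simp
    qed
    have "bootstrap_process (complete_graph s) Q (Suc m)"
      unfolding bootstrap_process_def
    proof (intro conjI allI impI ballI)
      fix i assume "i \<le> Suc m"
      then show "simple_graph (Q i)"
        using P(1) simp_sub[OF less.prems(1)] by (auto simp: Q_def bootstrap_process_def)
    next
      fix i assume i: "i \<in> {1..Suc m}"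
      show "\<exists>e. e \<notin> edges (Q (i - 1)) \<and> Q i = (verts (Q (i - 1)), insert e (edges (Q (i - 1)))) \<and>
        (\<exists>C. copy_of (complete_graph s) (Q i) C \<and> e \<in> edges C)"
      proof (cases "i = 1")
        case True
        have "copy_of (complete_graph s) (V, insert e H) (K, nsets K 2)"
          using K KV eE less.prems(1) by (subst copy_of_complete_graph_iff) (auto intro!: simp_sub)
        then show ?thesis using True K P(2)
          by (intro exI[of _ e]) (auto simp: Q_def)
      next
        case False
        then have "i - 1 \<in> {1..m}" "Q i = P (i - 1)" "Q (i - 1) = P (i - 1 - 1)"
          using i by (auto simp: Q_def)
        then show ?thesis using P(1) unfolding bootstrap_process_def by metis
      qed
    qed
    then show ?thesis using P by (intro exI[of _ "Suc m"] exI[of _ Q]) (auto simp: Q_def)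
  qed
qed

text \<open>
  A percolating subgraph with the fewest edges is automatically \<open>K\<^sub>s\<close>-free: an edge of a copy
  of \<open>K\<^sub>s\<close> could be deleted and recovered in one step.
\<close>

lemma weakly_saturated_of_percolated:
  assumes G: "simple_graph (V, E)" and "s \<ge> 2" "H \<subseteq> E" "E \<subseteq> percolated s E H"
  shows "\<exists>H'. weakly_saturated (V, E) (complete_graph s) (V, H') \<and> card H' \<le> card H"
proof -
  define A where "A = {H. H \<subseteq> E \<and> E \<subseteq> percolated s E H}"
  have "H \<in> A" using assms by (auto simp: A_def)
  then obtain H' where H': "H' \<in> A" and min: "\<And>F. F \<in> A \<Longrightarrow> card H' \<le> card F"
    using ex_has_least_nat[of "\<lambda>H. H \<in> A" H card] by blast
  have finE: "finite E"
    using G by (auto simp: simple_graph_def intro: finite_subset finite_imp_finite_nsets)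
  have sub: "H' \<subseteq> E" and perc: "E \<subseteq> percolated s E H'" using H' by (auto simp: A_def)
  then have finH': "finite H'" using finE finite_subset by blast
  have simple: "simple_graph (V, H')" using G sub by (auto simp: simple_graph_def)
  have "\<not> copy_of (complete_graph s) (V, H') C" for C
  proof
    assume "copy_of (complete_graph s) (V, H') C"
    then obtain K where K: "K \<subseteq> V" "card K = s" "finite K" "nsets K 2 \<subseteq> H'"
      using copy_of_complete_graph_iff[OF simple] by auto
    then obtain e where e: "e \<in> nsets K 2"
      using \<open>s \<ge> 2\<close> by (metis equals0I leD nsets_eq_empty_iff)
    have "e \<in> percolated s E (H' - {e})"
      by (rule percolated.step[of K]) (use K e sub in \<open>auto intro!: percolated.init\<close>)
    then have "H' \<subseteq> percolated s E (H' - {e})"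
      by (auto intro: percolated.init)
    then have "H' - {e} \<in> A"
      using percolated_closed perc sub unfolding A_def by blast
    then have "card H' \<le> card (H' - {e})" by (rule min)
    moreover have "card (H' - {e}) < card H'"
      using K e finH' by (intro card_Diff1_less) auto
    ultimately show False by simp
  qed
  then have "weakly_saturated (V, E) (complete_graph s) (V, H')"
    unfolding weakly_saturated_def
    using percolated_imp_bootstrap_process[OF G sub perc] simple G sub
    by (auto simp: spanning_subgraph_def subgraph_def)
  then show ?thesis using min[OF \<open>H \<in> A\<close>] by blast
qed

section \<open>The lower bound\<close>

text \<open>Gaussian elimination: an equation \<open>e0\<close> with a nonzero coefficient at
  \<open>i0\<close> is solved for \<open>x i0\<close> and substituted into the others, which leaves
  one equation and one unknown fewer.\<close>

lemma homogeneous_system_nontrivial_solution: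
  fixes c :: "'e \<Rightarrow> 'i \<Rightarrow> 'f :: field"
  assumes "finite E" "finite I" "card E < card I"
  shows "\<exists>x. (\<exists>i\<in>I. x i \<noteq> 0) \<and> (\<forall>e\<in>E. (\<Sum>i\<in>I. c e i * x i) = 0)"
  using assms
proof (induction E arbitrary: I c rule: finite_induct)
  case empty
  then have "I \<noteq> {}" by auto
  then show ?case by (intro exI[of _ "\<lambda>_. 1"]) auto
next
  case (insert e0 E)
  show ?case
  proof (cases "\<forall>i\<in>I. c e0 i = 0")
    case True
    obtain x where "\<exists>i\<in>I. x i \<noteq> 0" "\<forall>e\<in>E. (\<Sum>i\<in>I. c e i * x i) = 0"
      using insert.IH[of I c] insert.prems insert.hyps by auto
    then show ?thesis using True by (intro exI[of _ x]) auto
  next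
    case False
    then obtain i0 where i0: "i0 \<in> I" "c e0 i0 \<noteq> 0" by blast
    define J where "J = I - {i0}"
    have J: "finite J" "i0 \<notin> J" "I = insert i0 J" "card E < card J"
      using insert.prems insert.hyps i0 by (auto simp: J_def)
    define c' where "c' e i = c e i - c e i0 * c e0 i / c e0 i0" for e i
    obtain y where y: "\<exists>i\<in>J. y i \<noteq> 0" "\<And>e. e \<in> E \<Longrightarrow> (\<Sum>i\<in>J. c' e i * y i) = 0"
      using insert.IH[of J c'] J by blast
    \<comment> \<open>Back substitution: the value at \<open>i0\<close> is the one dictated by the
      equation \<open>e0\<close>.\<close>
    define x where "x = y(i0 := - (\<Sum>i\<in>J. c e0 i * y i) / c e0 i0)"
    have sum_x: "(\<Sum>i\<in>I. c e i * x i) =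
      (\<Sum>i\<in>J. c e i * y i) - c e i0 * (\<Sum>i\<in>J. c e0 i * y i) / c e0 i0" for e
    proof -
      have "(\<Sum>i\<in>J. c e i * x i) = (\<Sum>i\<in>J. c e i * y i)"
        using J(2) by (intro sum.cong) (auto simp: x_def)
      then show ?thesis using J by (simp add: x_def)
    qed
    have "(\<Sum>i\<in>I. c e i * x i) = 0" if "e \<in> insert e0 E" for e
    proof (cases "e = e0")
      case True
      then show ?thesis using i0 by (simp add: sum_x)
    next
      case False
      have "0 = (\<Sum>i\<in>J. c e i * y i - c e i0 * (c e0 i * y i) / c e0 i0)"
        using y(2)[of e] False that by (simp add: c'_def algebra_simps)
      then show ?thesis
        unfolding sum_x by (simp add: sum_subtractf sum_distrib_left sum_divide_distrib)
    qed
    moreover have "\<exists>i\<in>I. x i \<noteq> 0" using y(1) J by (auto simp: x_def)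
    ultimately show ?thesis by blast
  qed
qed

text \<open>The weights \<open>l u\<close> are the values at \<open>t\<close> of the Lagrange basis
  polynomials of the nodes \<open>T\<close>. They do not depend on the coefficients
  \<open>c\<close>, so the same weights serve all polynomials of degree less than \<open>d\<close>
  at once.\<close>

lemma Lagrange_interpolation:
  fixes T :: "'a :: field set"
  assumes "finite T" "card T = d"
  shows "\<exists>l. \<forall>c. (\<Sum>k<d. c k * t ^ k) = (\<Sum>u\<in>T. l u * (\<Sum>k<d. c k * u ^ k))"
proof (cases "d = 0")
  case True
  then show ?thesis by simp
next
  case False
  define L where "L u = smult (1 / (\<Prod>w\<in>T - {u}. u - w)) (\<Prod>w\<in>T - {u}. [:- w, 1:])" for u
  have L_deg: "degree (L u) < d" if "u \<in> T" for u
  proof -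
    have "degree (\<Prod>w\<in>T - {u}. [:- w, 1:]) \<le> (\<Sum>w\<in>T - {u}. degree [:- w, 1:])"
      using assms degree_prod_sum_le[of "T - {u}" "\<lambda>w. [:- w, 1:]"] by (simp add: o_def)
    also have "\<dots> < d" using assms that False by simp
    finally show ?thesis unfolding L_def by (meson degree_smult_le le_less_trans)
  qed
  have L_eq: "poly (L u) v = (if u = v then 1 else 0)" if "u \<in> T" "v \<in> T" for u v
    using assms that by (auto simp: L_def poly_prod)
  have "(\<Sum>k<d. c k * t ^ k) = (\<Sum>u\<in>T. poly (L u) t * (\<Sum>k<d. c k * u ^ k))" for c
  proof -
    define P where "P = (\<Sum>k<d. monom (c k) k)"
    have P: "poly P v = (\<Sum>k<d. c k * v ^ k)" for v
      by (simp add: P_def poly_sum poly_monom)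
    define R where "R = (\<Sum>u\<in>T. smult (poly P u) (L u))"
    have "P = R"
    proof (rule poly_eqI_degree[of T])
      fix v assume v: "v \<in> T"
      have "poly R v = (\<Sum>u\<in>T. poly P u * (if u = v then 1 else 0))"
        unfolding R_def poly_sum poly_smult using L_eq v by (intro sum.cong) auto
      also have "\<dots> = poly P v" using v assms by (simp add: sum.delta' if_distrib cong: if_cong)
      finally show "poly P v = poly R v" by simp
    next
      have "degree P < d" unfolding P_def
        using False by (intro degree_sum_less) (auto intro: le_less_trans[OF degree_monom_le])
      then show "degree P < card T" using assms by simp
      have "degree R < d" unfolding R_def
        using False L_deg by (intro degree_sum_less) (auto intro: le_less_trans[OF degree_smult_le])
      then show "degree R < card T" using assms by simp
    qed
    then have "poly P t = poly R t" by simp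
    then show ?thesis by (simp only: P R_def poly_sum poly_smult mult.commute)
  qed
  then show ?thesis by (intro exI[of _ "\<lambda>u. poly (L u) t"]) blast
qed

text \<open>
  Interpolating both \<open>f a\<close> and \<open>f b\<close> from the nodes in \<open>T\<close> gives
  \<open>f a b = (\<Sum>i\<in>T. \<Sum>j\<in>T. l\<^sub>b i * l\<^sub>a j * f i j)\<close>, which is symmetric in \<open>a\<close> and \<open>b\<close>.
\<close>

lemma symmetric_extension:
  fixes x :: "nat \<Rightarrow> nat \<Rightarrow> real" and d :: nat
  defines "f \<equiv> \<lambda>i j. \<Sum>k<d. x i k * real j ^ k"
  assumes T: "finite T" "card T = d"
    and a: "\<And>i. i \<in> T \<Longrightarrow> f a i = f i a" and b: "\<And>i. i \<in> T \<Longrightarrow> f b i = f i b"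
    and ij: "\<And>i j. i \<in> T \<Longrightarrow> j \<in> T \<Longrightarrow> f i j = f j i"
  shows "f a b = f b a"
proof -
  have "\<exists>l. \<forall>i. f i t = (\<Sum>u\<in>T. l u * f i u)" for t
  proof -
    obtain l where "\<forall>c. (\<Sum>k<d. c k * real t ^ k) = (\<Sum>u\<in>real ` T. l u * (\<Sum>k<d. c k * u ^ k))"
      using Lagrange_interpolation[of "real ` T" d "real t"] T by (auto simp: card_image)
    then show ?thesis unfolding f_def
      by (intro exI[of _ "\<lambda>u. l (real u)"]) (auto simp: sum.reindex)
  qed
  then obtain l where l: "\<And>t i. f i t = (\<Sum>u\<in>T. l t u * f i u)" by metis
  have "f a b = (\<Sum>i\<in>T. l b i * f i a)" by (subst l) (simp add: a)
  also have "\<dots> = (\<Sum>i\<in>T. \<Sum>j\<in>T. l b i * (l a j * f i j))"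
    by (subst l) (simp add: sum_distrib_left)
  also have "\<dots> = (\<Sum>j\<in>T. \<Sum>i\<in>T. l a j * (l b i * f j i))"
    by (subst sum.swap) (auto intro!: sum.cong simp: ij)
  also have "\<dots> = (\<Sum>j\<in>T. l a j * f j b)"
    by (subst (2) l) (simp add: sum_distrib_left)
  also have "\<dots> = f b a" by (subst (2) l) (simp add: b)
  finally show ?thesis .
qed

text \<open>
  The functions \<open>{i, j} \<mapsto> f i j - f j i\<close> (\<open>f i\<close> a polynomial of degree less than \<open>d\<close>) form
  a space of dimension \<open>d * n - d * (d + 1) / 2\<close>. Each of them that vanishes on \<open>H\<close> vanishes
  everywhere, because vanishing propagates along the percolation. The extra
  \<open>d * (d + 1) / 2\<close> equations below remove the kernel of \<open>f \<mapsto> (f i j - f j i)\<close>.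
\<close>

lemma card_percolating_ge:
  fixes n d :: nat
  assumes "d \<le> n" "E \<subseteq> nsets {1..n} 2" "H \<subseteq> E" "E \<subseteq> percolated (d + 2) E H"
    and ext: "\<And>u v. u \<in> {1..n} \<Longrightarrow> v \<in> {1..n} \<Longrightarrow> u \<noteq> v \<Longrightarrow>
      \<exists>T. finite T \<and> card T = d \<and> nsets T 2 \<subseteq> E \<and> (\<forall>t\<in>T. {u, t} \<in> E \<and> {v, t} \<in> E)"
  shows "2 * d * n \<le> 2 * card H + d * (d + 1)"
proof (rule ccontr)
  assume less: "\<not> ?thesis"
  \<comment> \<open>A pair \<open>(a, b)\<close> in \<open>B\<close>, with
    \<open>b \<le> a \<le> d\<close>, stands for the equation \<open>f b a = 0\<close>.\<close>
  define B where "B = (SIGMA j:{1..d}. {1..j})"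
  have cardB: "2 * card B = d * (d + 1)"
  proof -
    have "card B = (\<Sum>j=1..d. j)" by (simp add: B_def)
    also have "2 * \<dots> = d * (d + 1)" by (induction d) auto
    finally show ?thesis .
  qed
  have finB: "finite B" by (auto simp: B_def)
  have finH: "finite H"
    using assms(2,3) finite_imp_finite_nsets[of "{1..n}" 2] by (meson finite_atLeastAtMost finite_subset)
  define I where "I = {1..n} \<times> {..<d}"
  \<comment> \<open>The unknowns are the coefficients \<open>y (i, k)\<close> of the polynomials
    \<open>f i\<close>. A row \<open>Inl e\<close> says that the edge function vanishes at
    \<open>e\<close>, a row \<open>Inr (a, b)\<close> that \<open>f b a = 0\<close>. If the bound
    failed, there would be fewer rows than unknowns.\<close>
  define c :: "nat set + nat \<times> nat \<Rightarrow> nat \<times> nat \<Rightarrow> real" where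
    "c = case_sum
      (\<lambda>e (i, k). (if i = Min e then real (Max e) ^ k else 0) - (if i = Max e then real (Min e) ^ k else 0))
      (\<lambda>(a, b) (i, k). if i = b then real a ^ k else 0)"
  have "2 * (card H + card B) < 2 * (n * d)"
    using less cardB by (simp add: mult_ac)
  then have "finite (H <+> B)" "card (H <+> B) < card I"
    using finH finB by (auto simp: card_Plus I_def)
  then obtain y where y: "\<exists>i\<in>I. y i \<noteq> 0"
    "\<And>q. q \<in> H <+> B \<Longrightarrow> (\<Sum>i\<in>I. c q i * y i) = 0"
    using homogeneous_system_nontrivial_solution[of "H <+> B" I c] by (auto simp: I_def)
  define f where "f i j = (\<Sum>k<d. y (i, k) * real j ^ k)" for i j
  have sum_delta: "(\<Sum>i\<in>{1..n}. \<Sum>k<d. (if i = a then real b ^ k else 0) * y (i, k)) = f a b"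
    if "a \<in> {1..n}" for a b
  proof -
    have "(\<Sum>i\<in>{1..n}. \<Sum>k<d. (if i = a then real b ^ k else 0) * y (i, k)) =
       (\<Sum>i\<in>{1..n}. if i = a then f a b else 0)"
      unfolding f_def by (intro sum.cong) (auto simp: mult.commute)
    also have "\<dots> = f a b" using that by simp
    finally show ?thesis .
  qed
  have eqB: "f j i = 0" if "i \<in> {1..d}" "j \<in> {1..i}" for i j
  proof -
    have "j \<in> {1..n}" using that assms(1) by auto
    have "Inr (i, j) \<in> H <+> B" using that by (auto simp: B_def)
    then have "0 = (\<Sum>q\<in>I. c (Inr (i, j)) q * y q)" using y(2) by simp
    also have "\<dots> = (\<Sum>(a, k)\<in>I. (if a = j then real i ^ k else 0) * y (a, k))"
      by (intro sum.cong) (auto simp: c_def)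
    finally have "0 = (\<Sum>(a, k)\<in>I. (if a = j then real i ^ k else 0) * y (a, k))" .
    then show ?thesis using sum_delta[OF \<open>j \<in> {1..n}\<close>, of i]
      by (simp add: I_def sum.cartesian_product)
  qed
  have eqH: "f u v = f v u" if "{u, v} \<in> H" for u v
  proof -
    have *: "f (Min e) (Max e) = f (Max e) (Min e)" if "e \<in> H" for e
    proof -
      have e: "e \<in> nsets {1..n} 2" using that assms by auto
      then have "finite e" "e \<noteq> {}" "e \<subseteq> {1..n}" by (auto simp: nsets_def)
      then have m: "Min e \<in> {1..n}" "Max e \<in> {1..n}"
        using Min_in Max_in by blast+
      have "0 = (\<Sum>(a, k)\<in>I. ((if a = Min e then real (Max e) ^ k else 0) -
          (if a = Max e then real (Min e) ^ k else 0)) * y (a, k))"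
        using y(2)[of "Inl e"] that by (simp add: c_def case_prod_unfold InlI)
      also have "\<dots> = f (Min e) (Max e) - f (Max e) (Min e)"
        using sum_delta[OF m(1), of "Max e"] sum_delta[OF m(2), of "Min e"]
        by (simp add: I_def sum.cartesian_product left_diff_distrib sum_subtractf case_prod_unfold)
      finally show ?thesis by simp
    qed
    show ?thesis
      using *[OF that] by (cases u v rule: linorder_cases) (auto simp: min_def max_def)
  qed
  have eqP: "\<forall>u v. e = {u, v} \<longrightarrow> f u v = f v u" if "e \<in> percolated (d + 2) E H" for e
    using that
  proof induction
    case (init e)
    then show ?case using eqH by auto
  next
    case (step K e)
    show ?case
    proof (intro allI impI)
      fix u v assume e: "e = {u, v}"
      then have uv: "u \<in> K" "v \<in> K" "u \<noteq> v" using step by auto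
      have IH: "f i j = f j i" if "i \<in> K" "j \<in> K" "{i, j} \<noteq> {u, v}" for i j
        using step.IH[of "{i, j}"] that e by (cases "i = j") auto
      show "f u v = f v u"
      proof (rule symmetric_extension[where T = "K - {u, v}" and d = d and x = "\<lambda>i k. y (i, k)", folded f_def])
        show "f i j = f j i" if "i \<in> K - {u, v}" "j \<in> K - {u, v}" for i j
          using that by (intro IH) (auto simp: doubleton_eq_iff)
        show "f u t = f t u" "f v t = f t v" if "t \<in> K - {u, v}" for t
          using that uv by (auto intro!: IH simp: doubleton_eq_iff)
      qed (use uv step.hyps in auto)
    qed
  qed
  \<comment> \<open>For a pair outside \<open>E\<close> the clique \<open>T\<close> from
    \<open>ext\<close> takes the role of the rest of a K_s: all pairs in \<open>T\<close>, and all
    pairs from \<open>u\<close> or \<open>v\<close> to \<open>T\<close>, are edges, where symmetry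
    is known.\<close>
  have sym: "f u v = f v u" if uv: "u \<in> {1..n}" "v \<in> {1..n}" for u v
  proof (cases "u = v")
    case False
    obtain T where T: "finite T" "card T = d" "nsets T 2 \<subseteq> E" "\<forall>t\<in>T. {u, t} \<in> E \<and> {v, t} \<in> E"
      using ext[OF uv False] by blast
    have E: "f i j = f j i" if "{i, j} \<in> E" for i j using eqP assms(4) that by blast
    show ?thesis
    proof (rule symmetric_extension[where T = T and d = d and x = "\<lambda>i k. y (i, k)", folded f_def])
      show "f i j = f j i" if "i \<in> T" "j \<in> T" for i j
      proof (cases "i = j")
        case False
        then have "{i, j} \<in> nsets T 2" using that by simp
        then show ?thesis using T(3) by (intro E) blast
      qed simp
      show "f u t = f t u" "f v t = f t v" if "t \<in> T" for t
        using T(4) that by (blast intro: E)+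
    qed (use T in auto)
  qed simp
  \<comment> \<open>Symmetry and the rows \<open>Inr\<close> make \<open>f\<close> vanish on all
    pairs from \<open>{1..d}\<close>. So for \<open>j \<le> d\<close> the polynomial
    \<open>f j\<close> has \<open>d\<close> zeros and vanishes at every \<open>i\<close>; by
    symmetry every \<open>f i\<close> then vanishes at the \<open>d\<close> nodes
    \<open>{1..d}\<close>.\<close>
  have base: "f i j = 0" if "i \<in> {1..n}" "j \<in> {1..d}" for i j
  proof -
    have small: "f i j = 0" if "i \<in> {1..d}" "j \<in> {1..d}" for i j
      using eqB[of j i] eqB[of i j] sym[of i j] that assms(1) by (cases "i \<le> j") auto
    have zero: "f i t = 0" if "\<And>j. j \<in> {1..d} \<Longrightarrow> f i j = 0" for i t
    proof -
      obtain l where l: "\<And>c. (\<Sum>k<d. c k * real t ^ k) =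
          (\<Sum>u\<in>real ` {1..d}. l u * (\<Sum>k<d. c k * u ^ k))"
        using Lagrange_interpolation[of "real ` {1..d}" d "real t"] by (auto simp: card_image)
      have "f i t = (\<Sum>u\<in>real ` {1..d}. l u * (\<Sum>k<d. y (i, k) * u ^ k))"
        unfolding f_def using l[of "\<lambda>k. y (i, k)"] .
      also have "\<dots> = (\<Sum>u\<in>{1..d}. l (real u) * f i u)"
        by (simp add: sum.reindex f_def)
      also have "\<dots> = 0" using that by simp
      finally show ?thesis .
    qed
    have "f j i = 0" by (rule zero) (use small that in auto)
    then show ?thesis using sym[of i j] that assms(1) by auto
  qed
  have "y (i, k) = 0" if i: "i \<in> {1..n}" and k: "k < d" for i k
  proof -
    define P where "P = (\<Sum>k<d. monom (y (i, k)) k)"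
    have "P = 0"
    proof (rule poly_eqI_degree[of "real ` {1..d}"])
      show "poly P x = poly 0 x" if "x \<in> real ` {1..d}" for x
        using base[OF i] that by (auto simp: P_def f_def poly_sum poly_monom)
      have card: "card (real ` {1..d}) = d" by (simp add: card_image)
      have "degree P < d" unfolding P_def
        using k by (intro degree_sum_less) (auto intro: le_less_trans[OF degree_monom_le])
      then show "degree P < card (real ` {1..d})" by (simp only: card)
      show "degree (0 :: real poly) < card (real ` {1..d})" using k by (simp only: card degree_0)
    qed
    moreover have "coeff P k = y (i, k)"
      using k by (simp add: P_def coeff_sum)
    ultimately show ?thesis by simp
  qed
  then show False using y(1) by (auto simp: I_def)
qed

section \<open>Small percolating subgraphs\<close>

definition common_nbrs :: "'a set \<Rightarrow> 'a set set \<Rightarrow> 'a set \<Rightarrow> 'a set" where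
  "common_nbrs V E S = {x \<in> V. \<forall>v\<in>S. {v, x} \<in> E}"

text \<open>The case \<open>S = {}\<close> makes \<open>V\<close> nonempty, which supplies the root
  vertex of the induction for the upper bound.\<close>

definition extendable :: "nat \<Rightarrow> 'a set \<Rightarrow> 'a set set \<Rightarrow> bool" where
  "extendable k V E \<longleftrightarrow> (\<forall>S\<subseteq>V. card S \<le> k \<longrightarrow> common_nbrs V E S \<noteq> {})"

lemma extendableD:
  assumes "extendable k V E" "S \<subseteq> V" "card S \<le> k"
  obtains z where "z \<in> V" "\<And>v. v \<in> S \<Longrightarrow> {v, z} \<in> E"
  using assms by (auto simp: extendable_def common_nbrs_def)

lemma extendable_mono: "extendable k V E \<Longrightarrow> l \<le> k \<Longrightarrow> extendable l V E"
  by (auto simp: extendable_def)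

lemma singleton_notin_edges: "E \<subseteq> nsets V 2 \<Longrightarrow> {v} \<notin> E"
  by (auto simp: nsets_def)

lemma nsets_insert_2: "nsets (insert a T) 2 \<subseteq> nsets T 2 \<union> (\<lambda>t. {t, a}) ` T"
  by (auto simp: nsets_2_eq)

text \<open>The clique is chosen greedily, each vertex being a common neighbour of \<open>S\<close>
  and the vertices chosen before. The last of the \<open>j\<close> vertices is chosen against
  \<open>card S + j - 1\<close> others, whence the \<open>k + 1\<close>.\<close>

lemma extendable_clique:
  assumes "finite V" "E \<subseteq> nsets V 2" "extendable k V E" "S \<subseteq> V" "card S + j \<le> k + 1"
  shows "\<exists>T\<subseteq>common_nbrs V E S. finite T \<and> card T = j \<and> nsets T 2 \<subseteq> E"
  using assms(5)
proof (induction j)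
  case 0
  then show ?case by (intro exI[of _ "{}"]) (auto simp: nsets_def)
next
  case (Suc j)
  then obtain T where T: "T \<subseteq> common_nbrs V E S" "finite T" "card T = j" "nsets T 2 \<subseteq> E"
    by auto
  have TV: "T \<subseteq> V" using T by (auto simp: common_nbrs_def)
  have "card (S \<union> T) \<le> k" using card_Un_le[of S T] Suc.prems T by simp
  then obtain z where z: "z \<in> V" "\<And>v. v \<in> S \<union> T \<Longrightarrow> {v, z} \<in> E"
    using extendableD[OF assms(3), of "S \<union> T"] TV assms(4) by blast
  have "z \<notin> T"
    using z(2)[of z] singleton_notin_edges[OF assms(2)] by auto
  moreover have "nsets (insert z T) 2 \<subseteq> E"
    using z(2) T(4) nsets_insert_2[of z T] by blast
  ultimately show ?case using T z
    by (intro exI[of _ "insert z T"]) (auto simp: common_nbrs_def)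
qed

text \<open>The spread of edges from a fixed vertex \<open>v\<close> into the neighbourhood \<open>U\<close>: once \<open>v\<close> is
  joined to the \<open>d\<close> vertices of \<open>T\<close>, it becomes joined to all of \<open>U\<close>.\<close>

definition spreads :: "nat \<Rightarrow> 'a set set \<Rightarrow> 'a set \<Rightarrow> 'a set \<Rightarrow> bool" where
  "spreads d E U T \<longleftrightarrow> T \<subseteq> U \<and> finite T \<and> card T = d \<and>
    (\<forall>I\<subseteq>U. T \<subseteq> I \<longrightarrow>
      (\<forall>x\<in>U. \<forall>T'\<subseteq>I. finite T' \<longrightarrow> card T' = d \<longrightarrow> nsets T' 2 \<subseteq> E \<longrightarrow>
        (\<forall>t\<in>T'. {x, t} \<in> E) \<longrightarrow> x \<in> I) \<longrightarrow> I = U)"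

definition clique_connected :: "nat \<Rightarrow> 'a set set \<Rightarrow> 'a set \<Rightarrow> bool" where
  "clique_connected d E U \<longleftrightarrow> (\<exists>T. spreads d E U T)"

lemma spreadsD:
  assumes "spreads d E U T"
  shows "T \<subseteq> U" "finite T" "card T = d"
  using assms by (simp_all add: spreads_def)

lemma spreads_imp_eq:
  assumes "spreads d E U T" "I \<subseteq> U" "T \<subseteq> I"
    and "\<And>x T'. x \<in> U \<Longrightarrow> T' \<subseteq> I \<Longrightarrow> finite T' \<Longrightarrow> card T' = d \<Longrightarrow> nsets T' 2 \<subseteq> E \<Longrightarrow>
      (\<forall>t\<in>T'. {x, t} \<in> E) \<Longrightarrow> x \<in> I"
  shows "I = U"
proof -
  have "\<forall>x\<in>U. \<forall>T'\<subseteq>I. finite T' \<longrightarrow> card T' = d \<longrightarrow> nsets T' 2 \<subseteq> E \<longrightarrow>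
      (\<forall>t\<in>T'. {x, t} \<in> E) \<longrightarrow> x \<in> I"
    using assms(4) by simp
  then show ?thesis using assms(1-3) unfolding spreads_def by simp
qed

text \<open>For \<open>d = 1\<close> the spread is ordinary reachability from a single vertex: a
  closed proper subset would be a cut without edges.\<close>

lemma clique_connected_1I:
  assumes "U \<noteq> {}"
    and cut: "\<And>A. A \<subseteq> U \<Longrightarrow> A \<noteq> {} \<Longrightarrow> A \<noteq> U \<Longrightarrow> \<exists>a\<in>A. \<exists>b\<in>U - A. {a, b} \<in> E"
  shows "clique_connected 1 E U"
proof -
  obtain u where u: "u \<in> U" using assms by blast
  show ?thesis unfolding clique_connected_def spreads_def
  proof (intro exI[of _ "{u}"] conjI allI impI)
    fix I assume I: "I \<subseteq> U" "{u} \<subseteq> I"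
      and closed: "\<forall>x\<in>U. \<forall>T'\<subseteq>I. finite T' \<longrightarrow> card T' = 1 \<longrightarrow> nsets T' 2 \<subseteq> E \<longrightarrow>
        (\<forall>t\<in>T'. {x, t} \<in> E) \<longrightarrow> x \<in> I"
    show "I = U"
    proof (rule ccontr)
      assume "I \<noteq> U"
      then obtain a b where ab: "a \<in> I" "b \<in> U - I" "{a, b} \<in> E" using cut[of I] I by blast
      have "nsets {a} 2 \<subseteq> E" by (simp add: nsets_2_eq)
      then have "b \<in> I" using closed[rule_format, of b "{a}"] ab by (auto simp: insert_commute)
      then show False using ab by simp
    qed
  qed (use u in auto)
qed

text \<open>
  A \<open>d\<close>-clique \<open>Z\<close> in \<open>I\<close> is moved into the neighbourhood of \<open>x\<close> by repeatedly
  exchanging a vertex of \<open>Z\<close> for a common neighbour of \<open>Z\<close>, \<open>S\<close> and \<open>x\<close>.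
\<close>

lemma extendable_clique_connected:
  assumes "finite V" "E \<subseteq> nsets V 2" "extendable (d + 3) V E" "S \<subseteq> V" "card S \<le> 2"
  shows "clique_connected d E (common_nbrs V E S)"
proof -
  define U where "U = common_nbrs V E S"
  have UV: "U \<subseteq> V" by (auto simp: U_def common_nbrs_def)
  obtain T where T: "T \<subseteq> U" "finite T" "card T = d" "nsets T 2 \<subseteq> E"
    using extendable_clique[OF assms(1-4), of d] assms(5) by (auto simp: U_def)
  have "I = U" if I: "I \<subseteq> U" "T \<subseteq> I" and
    closed: "\<And>x T'. x \<in> U \<Longrightarrow> T' \<subseteq> I \<Longrightarrow> finite T' \<Longrightarrow> card T' = d \<Longrightarrow> nsets T' 2 \<subseteq> E \<Longrightarrow>
      (\<forall>t\<in>T'. {x, t} \<in> E) \<Longrightarrow> x \<in> I" for I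
  proof
    show "U \<subseteq> I"
    proof
      fix x assume x: "x \<in> U"
      define N where "N = {t. {x, t} \<in> E}"
      have "\<exists>Z\<subseteq>I. finite Z \<and> card Z = d \<and> nsets Z 2 \<subseteq> E \<and> j \<le> card (Z \<inter> N)" if "j \<le> d" for j
        using that
      proof (induction j)
        case 0
        then show ?case using T I by (intro exI[of _ T]) auto
      next
        case (Suc j)
        then obtain Z where Z: "Z \<subseteq> I" "finite Z" "card Z = d" "nsets Z 2 \<subseteq> E" "j \<le> card (Z \<inter> N)"
          by auto
        show ?case
        proof (cases "Suc j \<le> card (Z \<inter> N)")
          case True
          then show ?thesis using Z by blast
        next
          case False
          then have "Z \<inter> N \<noteq> Z" using Z Suc.prems by auto
          then obtain t where t: "t \<in> Z" "t \<notin> N" by blast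
          \<comment> \<open>The \<open>d\<close> vertices of \<open>Z\<close>, at most two of
            \<open>S\<close>, and \<open>x\<close> account for the \<open>d + 3\<close> in the
            hypothesis.\<close>
          have "card (insert x (S \<union> Z)) \<le> d + 3"
            using card_Un_le[of S Z] card_insert_le_m1[of "d + 3" "S \<union> Z" x] Z assms(5) by simp
          moreover have "insert x (S \<union> Z) \<subseteq> V" using x Z I UV assms(4) by blast
          ultimately obtain z where z: "z \<in> V" "\<And>v. v \<in> insert x (S \<union> Z) \<Longrightarrow> {v, z} \<in> E"
            using extendableD[OF assms(3)] by blast
          have zZ: "z \<notin> Z" using z(2)[of z] singleton_notin_edges[OF assms(2)] by auto
          have "z \<in> U" using z by (auto simp: U_def common_nbrs_def)
          \<comment> \<open>The new vertex is adjacent to the whole clique \<open>Z\<close> inside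
            \<open>I\<close>, so closure puts it into \<open>I\<close>; it thereby may replace
            \<open>t\<close>.\<close>
          then have "z \<in> I" using closed[of z Z] z Z by (auto simp: insert_commute)
          have "d > 0" using Z t(1) by (metis card_gt_0_iff empty_iff)
          have "nsets (insert z (Z - {t})) 2 \<subseteq> E"
            using z(2) Z(4) nsets_insert_2[of z "Z - {t}"] nsets_mono[of "Z - {t}" Z 2] by blast
          moreover have "insert z (Z - {t}) \<inter> N = insert z (Z \<inter> N)"
            using z t by (auto simp: N_def)
          moreover have "card (insert z (Z - {t})) = d"
            using zZ Z t \<open>d > 0\<close> by simp
          ultimately show ?thesis using Z zZ \<open>z \<in> I\<close>
            by (intro exI[of _ "insert z (Z - {t})"]) auto
        qed
      qed
      then obtain Z where Z: "Z \<subseteq> I" "finite Z" "card Z = d" "nsets Z 2 \<subseteq> E" "d \<le> card (Z \<inter> N)"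
        by blast
      then have "Z \<inter> N = Z" by (intro card_seteq) auto
      then show "x \<in> I" using closed[of x Z] x Z by (auto simp: N_def)
    qed
  qed (use I in auto)
  then show ?thesis unfolding clique_connected_def spreads_def U_def[symmetric]
    using T by (intro exI[of _ T]) auto
qed

section \<open>From a neighbourhood to the whole graph\<close>

text \<open>\<open>T\<close> together with \<open>a\<close> and \<open>b\<close> spans a clique on
  \<open>d + 2\<close> vertices in which only \<open>{a, b}\<close> is still to be recovered. Its
  other edges lie in \<open>E\<close> because percolated edges do.\<close>

lemma percolated_pair:
  assumes "finite T" "card T = d" "a \<noteq> b" "a \<notin> T" "b \<notin> T" "{a, b} \<in> E"
    and "nsets T 2 \<subseteq> percolated (d + 2) E H" "H \<subseteq> E"
    and "\<And>t. t \<in> T \<Longrightarrow> {a, t} \<in> percolated (d + 2) E H \<and> {b, t} \<in> percolated (d + 2) E H"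
  shows "{a, b} \<in> percolated (d + 2) E H"
proof -
  have "nsets (insert a (insert b T)) 2 \<subseteq>
      nsets T 2 \<union> (\<lambda>t. {b, t}) ` T \<union> (\<lambda>t. {a, t}) ` insert b T"
    using nsets_insert_2[of a "insert b T"] nsets_insert_2[of b T] by (simp add: insert_commute) blast
  then have *: "f \<in> percolated (d + 2) E H" if "f \<in> nsets (insert a (insert b T)) 2" "f \<noteq> {a, b}" for f
    using that assms(7,9) by blast
  moreover have "nsets (insert a (insert b T)) 2 \<subseteq> E"
    using * percolated_subset[OF assms(8)] assms(6) by blast
  ultimately show ?thesis
    using assms(1-5) percolated.step[of "insert a (insert b T)" "d + 2" E "{a, b}" H] by simp
qed

text \<open>Adding \<open>r\<close> to a clique on \<open>d + 1\<close> vertices in \<open>U\<close>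
  gives one on \<open>d + 2\<close> vertices, and its new edges all belong to \<open>H\<close>. So
  each step inside \<open>U\<close> lifts to a step in the whole graph.\<close>

lemma percolated_cone:
  assumes "e \<in> percolated (d + 1) (E \<inter> nsets U 2) H'" "E \<subseteq> nsets V 2"
    and "H' \<subseteq> H" "H \<subseteq> E" and r: "\<And>u. u \<in> U \<Longrightarrow> {r, u} \<in> H"
  shows "e \<in> percolated (d + 2) E H"
  using assms(1)
proof induction
  case (init e)
  then show ?case using assms by (auto intro: percolated.init)
next
  case (step K e)
  have rU: "r \<notin> U" using r[of r] assms(4) singleton_notin_edges[OF assms(2)] by auto
  have "e \<in> nsets U 2" using step by blast
  show ?case
  proof (cases "K \<subseteq> U")
    case False
    then obtain x where "x \<in> K" "x \<notin> U" by blast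
    \<comment> \<open>All pairs from \<open>K\<close> are pairs from \<open>U\<close>, so
      \<open>K\<close> can leave \<open>U\<close> only if it is a single vertex, and then it
      contains no edge \<open>e\<close>.\<close>
    then have "K = {x}"
    proof -
      have "y = x" if "y \<in> K" for y
      proof (rule ccontr)
        assume "y \<noteq> x"
        then have "{x, y} \<in> nsets K 2" using that \<open>x \<in> K\<close> by simp
        then have "{x, y} \<in> nsets U 2" using step by blast
        then show False using \<open>x \<notin> U\<close> by simp
      qed
      then show ?thesis using \<open>x \<in> K\<close> by blast
    qed
    then show ?thesis using step by (simp add: nsets_2_eq)
  next
    case True
    show ?thesis
    proof (rule percolated.step[of "insert r K"])
      have "r \<notin> K" using True rU by blast
      then show "card (insert r K) = d + 2" using step.hyps by simp
      show "e \<in> nsets (insert r K) 2" using step nsets_mono[of K "insert r K" 2] by blast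
      have split: "g \<in> nsets K 2 \<or> g \<in> H" if "g \<in> nsets (insert r K) 2" for g
      proof -
        have "g \<in> nsets K 2 \<or> (\<exists>x\<in>K. g = {r, x})"
          using nsets_insert_2[of r K] that by (auto simp: insert_commute)
        then show ?thesis using r True by auto
      qed
      show "nsets (insert r K) 2 \<subseteq> E"
        using split step.hyps(3) assms(4) by auto
      show "f \<in> percolated (d + 2) E H" if "f \<in> nsets (insert r K) 2" "f \<noteq> e" for f
        using split[OF that(1)] step.IH[of f] that(2) percolated.init[of f H "d + 2" E] by argo
      show "finite (insert r K)" using step.hyps by simp
    qed
  qed
qed

text \<open>Edges are recovered in four stages: those at \<open>r\<close> are given, those inside
  \<open>U\<close> come from \<open>H'\<close> by the cone argument, those from an outside vertex
  \<open>v\<close> to \<open>U\<close> by spreading from \<open>T v\<close>, and those between two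
  outside vertices through a clique in \<open>U\<close>. The count is \<open>card U\<close> for the
  star at \<open>r\<close> and \<open>d\<close> for each outside vertex.\<close>

lemma percolating_extension:
  assumes V: "finite V" "E \<subseteq> nsets V 2" and r: "r \<in> V"
  defines "U \<equiv> common_nbrs V E {r}"
  assumes H': "H' \<subseteq> E \<inter> nsets U 2" "E \<inter> nsets U 2 \<subseteq> percolated (d + 1) (E \<inter> nsets U 2) H'"
    and ext: "extendable (d + 2) V E"
    and conn: "\<And>v. v \<in> V - insert r U \<Longrightarrow> clique_connected d E (common_nbrs V E {r, v})"
  shows "\<exists>H\<subseteq>E. card H \<le> card H' + card U + d * (card V - card U - 1) \<and>
    E \<subseteq> percolated (d + 2) E H"
proof -
  let ?W = "V - insert r U"
  have UV: "U \<subseteq> V" by (auto simp: U_def common_nbrs_def)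
  have rU: "r \<notin> U" using singleton_notin_edges[OF V(2)] by (simp add: U_def common_nbrs_def)
  have "finite U" using UV V(1) by (rule finite_subset)
  define T where "T v = (SOME T. spreads d E (common_nbrs V E {r, v}) T)" for v
  have spr: "spreads d E (common_nbrs V E {r, v}) (T v)" if "v \<in> ?W" for v
    using conn[OF that] unfolding clique_connected_def T_def by (rule someI_ex)
  have T: "T v \<subseteq> common_nbrs V E {r, v}" "finite (T v)" "card (T v) = d" if "v \<in> ?W" for v
    by (rule spreadsD[OF spr[OF that]])+
  define H where "H = H' \<union> (\<lambda>u. {r, u}) ` U \<union> (\<Union>v\<in>?W. (\<lambda>t. {v, t}) ` T v)"
  have HE: "H \<subseteq> E"
  proof -
    have "(\<lambda>u. {r, u}) ` U \<subseteq> E" by (auto simp: U_def common_nbrs_def)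
    moreover have "(\<lambda>t. {v, t}) ` T v \<subseteq> E" if "v \<in> ?W" for v
      using T(1)[OF that] by (auto simp: common_nbrs_def)
    moreover have "H' \<subseteq> E" using H'(1) by blast
    ultimately show ?thesis unfolding H_def by (intro Un_least UN_least)
  qed
  have "card H \<le> card H' + card U + d * (card V - card U - 1)"
  proof -
    have "card (\<Union>v\<in>?W. (\<lambda>t. {v, t}) ` T v) \<le> (\<Sum>v\<in>?W. card ((\<lambda>t. {v, t}) ` T v))"
      using V by (intro card_UN_le) auto
    also have "\<dots> \<le> (\<Sum>v\<in>?W. d)"
      using card_image_le[OF T(2)] T(3) by (intro sum_mono) fastforce
    also have "\<dots> = d * (card V - card U - 1)"
      using V UV rU r \<open>finite U\<close> by (simp add: card_Diff_subset)
    finally have 1: "card (\<Union>v\<in>?W. (\<lambda>t. {v, t}) ` T v) \<le> d * (card V - card U - 1)" .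
    have 2: "card ((\<lambda>u. {r, u}) ` U) \<le> card U" using \<open>finite U\<close> by (rule card_image_le)
    have "card H \<le> card H' + card ((\<lambda>u. {r, u}) ` U) + card (\<Union>v\<in>?W. (\<lambda>t. {v, t}) ` T v)"
      unfolding H_def
      using card_Un_le[of H' "(\<lambda>u. {r, u}) ` U"]
        card_Un_le[of "H' \<union> (\<lambda>u. {r, u}) ` U" "\<Union>v\<in>?W. (\<lambda>t. {v, t}) ` T v"]
      by linarith
    then show ?thesis using 1 2 by linarith
  qed
  moreover have "E \<subseteq> percolated (d + 2) E H"
  proof -
    let ?P = "percolated (d + 2) E H"
    have star: "{r, u} \<in> ?P" if "u \<in> U" for u
      using that by (auto simp: H_def intro!: percolated.init)
    have inner: "e \<in> ?P" if "e \<in> E" "e \<in> nsets U 2" for e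
    proof (rule percolated_cone[OF _ V(2) _ HE])
      show "e \<in> percolated (d + 1) (E \<inter> nsets U 2) H'" using that H' by blast
      show "H' \<subseteq> H" by (auto simp: H_def)
      show "{r, u} \<in> H" if "u \<in> U" for u using that by (auto simp: H_def)
    qed
    have cross: "{v, x} \<in> ?P" if v: "v \<in> ?W" and x: "x \<in> common_nbrs V E {r, v}" for v x
    proof -
      \<comment> \<open>The vertices already joined to \<open>v\<close>. This set contains
        \<open>T v\<close> and is closed under the spreading rule, so it is the whole common
        neighbourhood.\<close>
      define I where "I = {x \<in> common_nbrs V E {r, v}. {v, x} \<in> ?P}"
      have NU: "common_nbrs V E {r, v} \<subseteq> U" by (auto simp: common_nbrs_def U_def)
      have "I = common_nbrs V E {r, v}"
      proof (rule spreads_imp_eq[OF spr[OF v]])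
        show "I \<subseteq> common_nbrs V E {r, v}" by (auto simp: I_def)
        show "T v \<subseteq> I" using T(1)[OF v] v by (auto simp: I_def H_def intro!: percolated.init)
        show "x \<in> I" if x: "x \<in> common_nbrs V E {r, v}" and
            T': "T' \<subseteq> I" "finite T'" "card T' = d" "nsets T' 2 \<subseteq> E" "\<forall>t\<in>T'. {x, t} \<in> E" for x T'
        proof -
          have T'U: "T' \<subseteq> U" using T' NU by (auto simp: I_def)
          have "{v, x} \<in> ?P"
          proof (rule percolated_pair[of T'])
            show "v \<noteq> x" "v \<notin> T'" using v x NU T'U by auto
            show "x \<notin> T'" using T'(5) singleton_notin_edges[OF V(2)] by auto
            show "{v, x} \<in> E" using x by (auto simp: common_nbrs_def)
            show "nsets T' 2 \<subseteq> ?P" using inner T' T'U nsets_mono[of T' U 2] by blast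
            show "{v, t} \<in> ?P \<and> {x, t} \<in> ?P" if "t \<in> T'" for t
            proof
              show "{v, t} \<in> ?P" using that T' by (auto simp: I_def)
              have "{x, t} \<in> E" using T' that by blast
              moreover have "{x, t} \<in> nsets U 2"
                using that T'U x NU \<open>x \<notin> T'\<close> by auto
              ultimately show "{x, t} \<in> ?P" by (rule inner)
            qed
          qed (use T' HE in auto)
          then show "x \<in> I" using x by (simp add: I_def)
        qed
      qed
      then show ?thesis using x by (auto simp: I_def)
    qed
    have outer: "{v, w} \<in> ?P" if vw: "v \<in> ?W" "w \<in> ?W" "{v, w} \<in> E" for v w
    proof -
      have "v \<noteq> w" using vw singleton_notin_edges[OF V(2)] by auto
      \<comment> \<open>Including \<open>r\<close> forces the clique into \<open>U\<close>, where
        all edges are known. Three vertices and a \<open>d\<close>-clique are exactly what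
        \<open>extendable (d + 2)\<close> provides.\<close>
      have "card {r, v, w} \<le> 3" by (simp add: card_insert_if)
      then obtain S where S: "S \<subseteq> common_nbrs V E {r, v, w}" "finite S" "card S = d" "nsets S 2 \<subseteq> E"
        using extendable_clique[OF V ext, of "{r, v, w}" d] r vw by auto
      have SU: "S \<subseteq> U" using S(1) by (auto simp: common_nbrs_def U_def)
      show ?thesis
      proof (rule percolated_pair[of S])
        show "nsets S 2 \<subseteq> ?P" using inner S SU nsets_mono[of S U 2] by blast
        show "{v, t} \<in> ?P \<and> {w, t} \<in> ?P" if "t \<in> S" for t
          using cross[of v t] cross[of w t] vw that S(1) by (auto simp: common_nbrs_def)
      qed (use \<open>v \<noteq> w\<close> vw S HE SU in auto)
    qed
    show ?thesis
    proof
      fix e assume e: "e \<in> E"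
      then have "e \<in> nsets V 2" using V(2) by blast
      then obtain a b where ab: "e = {a, b}" "a \<in> V" "b \<in> V" "a \<noteq> b" by (rule nsets2_E)
      have *: "e \<in> ?P" if c: "e = {a, b}" "a \<in> V" "b \<in> V" "a \<noteq> b"
        "a = r \<or> (a \<in> ?W \<and> b \<noteq> r) \<or> (a \<in> U \<and> b \<in> U)" for a b
        using that(5)
      proof (elim disjE conjE)
        assume "a = r"
        then have "b \<in> U" using that e by (auto simp: U_def common_nbrs_def)
        then show ?thesis using star that \<open>a = r\<close> by auto
      next
        assume "a \<in> ?W" "b \<noteq> r"
        then consider "b \<in> U" | "b \<in> ?W" using c(3) by blast
        then show ?thesis
        proof cases
          case 1
          then have "b \<in> common_nbrs V E {r, a}" using that e by (auto simp: U_def common_nbrs_def)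
          then show ?thesis using cross[OF \<open>a \<in> ?W\<close>] that by blast
        next
          case 2
          then show ?thesis using outer[OF \<open>a \<in> ?W\<close>] that e by blast
        qed
      next
        assume "a \<in> U" "b \<in> U"
        then show ?thesis using inner[of e] that e by auto
      qed
      show "e \<in> ?P"
        using *[of a b] *[of b a] ab by (auto simp: insert_commute)
    qed
  qed
  ultimately show ?thesis using HE by blast
qed

section \<open>Percolating sets of the optimal size\<close>

text \<open>The bound is \<open>card H \<le> d * card V - d * (d + 1) / 2\<close>, doubled and
  rearranged to avoid division and truncated subtraction; \<open>d\<close> stands for
  \<open>s - 2\<close>.\<close>

definition has_small_percolating_set :: "nat \<Rightarrow> 'a set \<Rightarrow> 'a set set \<Rightarrow> bool" where
  "has_small_percolating_set d V E \<longleftrightarrow>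
    (\<exists>H\<subseteq>E. 2 * card H + d * (d + 1) \<le> 2 * d * card V \<and> E \<subseteq> percolated (d + 2) E H)"

text \<open>Every edge is itself a copy of K_2, so the empty set percolates.\<close>

lemma has_small_percolating_set_0:
  assumes "E \<subseteq> nsets V 2"
  shows "has_small_percolating_set 0 V E"
proof -
  have "e \<in> percolated 2 E {}" if "e \<in> E" for e
  proof -
    have "e \<in> nsets V 2" using that assms by blast
    then obtain a b where e: "e = {a, b}" "a \<noteq> b" by (rule nsets2_E)
    show ?thesis by (rule percolated.step[of e]) (use e that in auto)
  qed
  then show ?thesis unfolding has_small_percolating_set_def
    by (intro exI[of _ "{}"]) (auto simp: numeral_2_eq_2)
qed

text \<open>With \<open>card V = card U + 1 + t\<close>, the bound
  \<open>d * card U - d * (d + 1) / 2\<close> for \<open>H'\<close>, plus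
  \<open>card U + (d + 1) * t\<close> new edges, adds up exactly to the bound for
  \<open>Suc d\<close>.\<close>

lemma has_small_percolating_set_Suc:
  assumes V: "finite V" "E \<subseteq> nsets V 2" and r: "r \<in> V"
  defines "U \<equiv> common_nbrs V E {r}"
  assumes IH: "has_small_percolating_set d U (E \<inter> nsets U 2)"
    and ext: "extendable (d + 3) V E"
    and conn: "\<And>v. v \<in> V - insert r U \<Longrightarrow> clique_connected (Suc d) E (common_nbrs V E {r, v})"
  shows "has_small_percolating_set (Suc d) V E"
proof -
  obtain H' where H': "H' \<subseteq> E \<inter> nsets U 2" "2 * card H' + d * (d + 1) \<le> 2 * d * card U"
      "E \<inter> nsets U 2 \<subseteq> percolated (d + 2) (E \<inter> nsets U 2) H'"
    using IH by (auto simp: has_small_percolating_set_def)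
  have "\<exists>H\<subseteq>E. card H \<le> card H' + card U + Suc d * (card V - card U - 1) \<and>
    E \<subseteq> percolated (Suc d + 2) E H"
  proof (rule percolating_extension[OF V r, folded U_def, OF H'(1)])
    show "E \<inter> nsets U 2 \<subseteq> percolated (Suc d + 1) (E \<inter> nsets U 2) H'"
      using H'(3) by simp
    show "extendable (Suc d + 2) V E" using ext by (simp add: eval_nat_numeral)
  qed (rule conn)
  then obtain H where H: "H \<subseteq> E" "card H \<le> card H' + card U + Suc d * (card V - card U - 1)"
    "E \<subseteq> percolated (Suc d + 2) E H" by blast
  have "insert r U \<subseteq> V" "r \<notin> U" "finite U"
    using V r singleton_notin_edges[OF V(2)]
    by (auto simp: U_def common_nbrs_def intro: finite_subset)
  then have "card V \<ge> card U + 1" using card_mono[OF V(1), of "insert r U"] by simp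
  then obtain t where t: "card V = card U + 1 + t" using le_iff_add by blast
  have "2 * card H + Suc d * (Suc d + 1) \<le>
      2 * (card H' + card U + Suc d * t) + Suc d * (Suc d + 1)"
    using H(2) t by simp
  also have "\<dots> = 2 * card H' + d * (d + 1) + 2 * card U + 2 * Suc d * t + 2 * Suc d"
    by (simp add: algebra_simps)
  also have "\<dots> \<le> 2 * d * card U + 2 * card U + 2 * Suc d * t + 2 * Suc d"
    using H'(2) by simp
  also have "\<dots> = 2 * Suc d * card V" unfolding t by (simp add: algebra_simps)
  finally show ?thesis unfolding has_small_percolating_set_def using H by blast
qed

text \<open>A common neighbour of \<open>insert r S\<close> lies in \<open>U\<close>; including
  \<open>r\<close> costs one unit of extendability.\<close>

lemma extendable_nbhd:
  assumes "E \<subseteq> nsets V 2" "extendable (Suc k) V E" "r \<in> V"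
  defines "U \<equiv> common_nbrs V E {r}"
  shows "extendable k U (E \<inter> nsets U 2)"
  unfolding extendable_def
proof (intro allI impI)
  fix S assume S: "S \<subseteq> U" "card S \<le> k"
  have "insert r S \<subseteq> V" using S assms(3) by (auto simp: U_def common_nbrs_def)
  moreover have "card (insert r S) \<le> Suc k" using S card_insert_le_m1[of "Suc k" S r] by simp
  ultimately obtain z where z: "z \<in> V" "\<And>v. v \<in> insert r S \<Longrightarrow> {v, z} \<in> E"
    using extendableD[OF assms(2)] by blast
  have "z \<in> U" using z by (auto simp: U_def common_nbrs_def)
  moreover have "{v, z} \<in> nsets U 2" if "v \<in> S" for v
    using that S \<open>z \<in> U\<close> z(2)[of v] singleton_notin_edges[OF assms(1), of z] by auto
  ultimately have "z \<in> common_nbrs U (E \<inter> nsets U 2) S"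
    using z by (auto simp: common_nbrs_def)
  then show "common_nbrs U (E \<inter> nsets U 2) S \<noteq> {}" by blast
qed

text \<open>Passing to the neighbourhood of a root lowers both \<open>d\<close> and the
  extendability by one, so the hypothesis reproduces itself along the induction.\<close>

lemma has_small_percolating_set_extendable:
  assumes "finite V" "E \<subseteq> nsets V 2" "extendable (d + 3) V E"
  shows "has_small_percolating_set d V E"
  using assms
proof (induction d arbitrary: V E)
  case 0
  then show ?case using has_small_percolating_set_0 by blast
next
  case (Suc d)
  obtain r where r: "r \<in> V"
    using extendableD[OF Suc.prems(3), of "{}"] by auto
  let ?U = "common_nbrs V E {r}"
  show ?case
  proof (rule has_small_percolating_set_Suc[OF Suc.prems(1,2) r])
    show "has_small_percolating_set d ?U (E \<inter> nsets ?U 2)"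
    proof (rule Suc.IH)
      show "finite ?U" using Suc.prems(1) by (auto simp: common_nbrs_def)
      show "extendable (d + 3) ?U (E \<inter> nsets ?U 2)"
        using Suc.prems(3) by (intro extendable_nbhd[OF Suc.prems(2) _ r]) simp
    qed simp
    show "extendable (d + 3) V E" using Suc.prems(3) by (rule extendable_mono) simp
    show "clique_connected (Suc d) E (common_nbrs V E {r, v})" if "v \<in> V - insert r ?U" for v
      by (rule extendable_clique_connected[OF Suc.prems]) (use that r in \<open>auto simp: card_insert_if\<close>)
  qed
qed

text \<open>Connectedness of the graph induced on \<open>U\<close>, phrased by cuts so that a union
  bound over cuts applies. The empty set counts as connected.\<close>

definition cut_connected :: "'a set set \<Rightarrow> 'a set \<Rightarrow> bool" where
  "cut_connected E U \<longleftrightarrow> (\<forall>A\<subseteq>U. A \<noteq> {} \<longrightarrow> A \<noteq> U \<longrightarrow> (\<exists>a\<in>A. \<exists>b\<in>U - A. {a, b} \<in> E))"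

text \<open>The case s = 3, where the threshold yields only \<open>extendable 3\<close> and not the
  \<open>extendable 4\<close> asked for by the general induction. Connected common neighbourhoods
  replace the missing unit; their nonemptiness follows from \<open>ext\<close>.\<close>

lemma has_small_percolating_set_1:
  assumes V: "finite V" "E \<subseteq> nsets V 2" and r: "r \<in> V" and ext: "extendable 3 V E"
    and conn: "\<And>v. v \<in> V - {r} \<Longrightarrow> cut_connected E (common_nbrs V E {r, v})"
  shows "has_small_percolating_set 1 V E"
proof -
  have "has_small_percolating_set (Suc 0) V E"
  proof (rule has_small_percolating_set_Suc[OF V r])
    show "has_small_percolating_set 0 (common_nbrs V E {r}) (E \<inter> nsets (common_nbrs V E {r}) 2)"
      by (rule has_small_percolating_set_0) simp
    show "extendable (0 + 3) V E" using ext by simp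
    fix v assume v: "v \<in> V - insert r (common_nbrs V E {r})"
    have "common_nbrs V E {r, v} \<noteq> {}"
      using ext v r unfolding extendable_def by (simp add: card_insert_if)
    moreover have "cut_connected E (common_nbrs V E {r, v})" using conn v by simp
    ultimately have "clique_connected 1 E (common_nbrs V E {r, v})"
      unfolding cut_connected_def by (intro clique_connected_1I) simp_all
    then show "clique_connected (Suc 0) E (common_nbrs V E {r, v})" by simp
  qed
  then show ?thesis by simp
qed

section \<open>A deterministic criterion for the property\<close>

text \<open>All graphs of the process lie below the final one, so every clique completed on the way
  is a clique of the host \<open>E\<close>.\<close>

lemma bootstrap_process_imp_percolated:
  assumes P: "bootstrap_process (complete_graph s) P m" and m: "P m = (V, E)"
  shows "E \<subseteq> percolated s E (edges (P 0))"
proof -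
  have adds: "\<exists>e K. edges (P i) = insert e (edges (P (i - 1))) \<and>
      finite K \<and> card K = s \<and> nsets K 2 \<subseteq> edges (P i) \<and> e \<in> nsets K 2" if i: "i \<in> {1..m}" for i
  proof -
    obtain e C where e: "P i = (verts (P (i - 1)), insert e (edges (P (i - 1))))"
      "copy_of (complete_graph s) (P i) C" "e \<in> edges C"
      using P i unfolding bootstrap_process_def by blast
    have "simple_graph (P i)" using P i unfolding bootstrap_process_def by simp
    then obtain K where "card K = s" "finite K" "nsets K 2 \<subseteq> edges (P i)" "C = (K, nsets K 2)"
      using copy_of_complete_graph_iff e(2) by blast
    moreover have "edges (P i) = insert e (edges (P (i - 1)))" by (subst e(1)) simp
    ultimately show ?thesis using e(3) by auto
  qed
  have mono: "edges (P i) \<subseteq> E" if "i \<le> m" for i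
    using that
  proof (induction rule: inc_induct)
    case base
    then show ?case using m by simp
  next
    case (step i)
    then show ?case using adds[of "Suc i"] by auto
  qed
  have "edges (P i) \<subseteq> percolated s E (edges (P 0))" if "i \<le> m" for i
    using that
  proof (induction i)
    case 0
    then show ?case by (auto intro: percolated.init)
  next
    case (Suc i)
    then obtain e K where eK: "edges (P (Suc i)) = insert e (edges (P i))"
      "finite K" "card K = s" "nsets K 2 \<subseteq> edges (P (Suc i))" "e \<in> nsets K 2"
      using adds[of "Suc i"] by auto
    have "e \<in> percolated s E (edges (P 0))"
    proof (rule percolated.step[OF eK(2,3) _ eK(5)])
      show "nsets K 2 \<subseteq> E" using eK(4) mono[of "Suc i"] Suc.prems by blast
      show "f \<in> percolated s E (edges (P 0))" if "f \<in> nsets K 2" "f \<noteq> e" for f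
        using that eK(1,4) Suc by auto
    qed
    then show ?case using Suc eK(1) by simp
  qed
  from this[of m] show ?thesis using m by simp
qed

text \<open>The dimension bound applies to every weakly saturated subgraph, and the small
  percolating set yields one that attains it. Two vertices and a \<open>d\<close>-clique in their
  common neighbourhood account for \<open>extendable (d + 1)\<close>.\<close>

lemma property_A_if_percolating:
  assumes "s \<ge> 3" and d: "d = s - 2" and "d \<le> n" and E: "E \<subseteq> nsets {1..n} 2"
    and small: "has_small_percolating_set d {1..n} E" and ext: "extendable (d + 1) {1..n} E"
  shows "property_A s ({1..n}, E)"
proof -
  have s: "s = d + 2" using assms by simp
  have G: "simple_graph ({1..n}, E)" using E by (simp add: simple_graph_def)
  have lower: "2 * d * n \<le> 2 * card (edges F) + d * (d + 1)"
    if F: "weakly_saturated ({1..n}, E) (complete_graph s) F" for F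
  proof -
    obtain m P where P: "bootstrap_process (complete_graph s) P m" "P 0 = F" "P m = ({1..n}, E)"
      using F unfolding weakly_saturated_def by blast
    show ?thesis
    proof (rule card_percolating_ge[OF \<open>d \<le> n\<close> E])
      show "edges F \<subseteq> E"
        using F by (simp add: weakly_saturated_def spanning_subgraph_def subgraph_def)
      show "E \<subseteq> percolated (d + 2) E (edges F)"
        using bootstrap_process_imp_percolated[OF P(1,3)] P(2) s by simp
      fix u v assume "u \<in> {1..n}" "v \<in> {1..n}" "u \<noteq> v"
      then obtain T where "T \<subseteq> common_nbrs {1..n} E {u, v}" "finite T" "card T = d" "nsets T 2 \<subseteq> E"
        using extendable_clique[OF _ E ext, of "{u, v}" d] by auto
      then show "\<exists>T. finite T \<and> card T = d \<and> nsets T 2 \<subseteq> E \<and> (\<forall>t\<in>T. {u, t} \<in> E \<and> {v, t} \<in> E)"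
        by (intro exI[of _ T]) (auto simp: common_nbrs_def)
    qed
  qed
  obtain H where H: "H \<subseteq> E" "2 * card H + d * (d + 1) \<le> 2 * d * n" "E \<subseteq> percolated s E H"
    using small s by (auto simp: has_small_percolating_set_def)
  obtain H' where H': "weakly_saturated ({1..n}, E) (complete_graph s) ({1..n}, H')" "card H' \<le> card H"
    using weakly_saturated_of_percolated[OF G _ H(1,3)] s by auto
  have eq: "2 * card H' + d * (d + 1) = 2 * d * n"
    using lower[OF H'(1)] H(2) H'(2) by simp
  have "wsat ({1..n}, E) (complete_graph s) = card H'"
    unfolding wsat_def
  proof (rule Least_equality)
    show "\<exists>F. weakly_saturated ({1..n}, E) (complete_graph s) F \<and> card (edges F) = card H'"
      using H'(1) by (intro exI[of _ "({1..n}, H')"]) simp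
    show "card H' \<le> k"
      if "\<exists>F. weakly_saturated ({1..n}, E) (complete_graph s) F \<and> card (edges F) = k" for k
      using that lower eq by fastforce
  qed
  moreover have "2 * int (card H') = 2 * (int (d choose 2) + int d * (int n - int d))"
  proof -
    have "2 * (d choose 2) + d = d * d"
      by (cases d) (auto simp: choose_two)
    then have "2 * int (d choose 2) + int d = int d * int d"
      by (metis of_nat_add of_nat_mult of_nat_numeral)
    moreover have "2 * int (card H') + int d * (int d + 1) = 2 * int d * int n"
      using arg_cong[OF eq, of int] by (simp add: algebra_simps)
    ultimately show ?thesis by (simp add: algebra_simps)
  qed
  ultimately show ?thesis
    unfolding property_A_def using s by simp
qed

section \<open>Random graphs\<close>

lemma common_nbrs_antimono: "S \<subseteq> T \<Longrightarrow> common_nbrs V E T \<subseteq> common_nbrs V E S"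
  by (auto simp: common_nbrs_def)

lemma cut_connected_cong:
  assumes "\<And>a b. a \<in> W \<Longrightarrow> b \<in> W \<Longrightarrow> {a, b} \<in> E \<longleftrightarrow> {a, b} \<in> F"
  shows "cut_connected E W = cut_connected F W"
proof -
  have "(\<exists>a\<in>A. \<exists>b\<in>W - A. {a, b} \<in> E) = (\<exists>a\<in>A. \<exists>b\<in>W - A. {a, b} \<in> F)" if "A \<subseteq> W" for A
    using that by (intro bex_cong refl assms) auto
  then show ?thesis by (simp add: cut_connected_def)
qed

section \<open>Independence of coin flips\<close>

text \<open>The product distribution over \<open>A\<close> is a pair of independent products over
  \<open>B\<close> and \<open>A - B\<close>; \<open>X\<close> depends on the first component only
  and \<open>Y\<close> on the second.\<close>

lemma prob_Pi_pmf_indep: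
  fixes A :: "'a set" and p :: "'a \<Rightarrow> 'b pmf"
  assumes A: "finite A" and B: "B \<subseteq> A"
    and X: "\<And>f g. (\<And>x. x \<in> B \<Longrightarrow> f x = g x) \<Longrightarrow> X f = X g"
    and Y: "\<And>f g. (\<And>x. x \<notin> B \<Longrightarrow> f x = g x) \<Longrightarrow> Y f = Y g"
  shows "measure_pmf.prob (Pi_pmf A d p) {f. X f \<and> Y f} =
    measure_pmf.prob (Pi_pmf A d p) {f. X f} * measure_pmf.prob (Pi_pmf A d p) {f. Y f}"
proof -
  define M where "M = Pi_pmf B d p"
  define N where "N = Pi_pmf (A - B) d p"
  define h where "h = (\<lambda>(f, g) x. if x \<in> B then f x else (g x :: 'b))"
  have eq: "Pi_pmf A d p = map_pmf h (pair_pmf M N)"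
    using Pi_pmf_union[of B "A - B" d p] A B finite_subset[OF B A]
    by (simp add: M_def N_def h_def Un_absorb1)
  have prod: "measure_pmf.prob (Pi_pmf A d p) {f. X' f \<and> Y' f} =
      measure_pmf.prob M {f. X' f} * measure_pmf.prob N {f. Y' f}"
    if X': "\<And>f g. (\<And>x. x \<in> B \<Longrightarrow> f x = g x) \<Longrightarrow> X' f = X' g"
      and Y': "\<And>f g. (\<And>x. x \<notin> B \<Longrightarrow> f x = g x) \<Longrightarrow> Y' f = Y' g" for X' Y'
  proof -
    have "X' (h (f, g)) = X' f" for f g by (rule X') (simp add: h_def)
    moreover have "Y' (h (f, g)) = Y' g" for f g by (rule Y') (simp add: h_def)
    ultimately have "h -` {f. X' f \<and> Y' f} = {f. X' f} \<times> {f. Y' f}" by auto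
    then have "measure_pmf.prob (Pi_pmf A d p) {f. X' f \<and> Y' f} =
        measure_pmf.prob (pair_pmf M N) ({f. X' f} \<times> {f. Y' f})"
      unfolding eq by simp
    \<comment> \<open>Restricting to the supports makes both sides of the rectangle countable, as
      the product rule for probabilities requires.\<close>
    also have "\<dots> = measure_pmf.prob (pair_pmf M N)
        (({f. X' f} \<inter> set_pmf M) \<times> ({f. Y' f} \<inter> set_pmf N))"
      by (rule measure_prob_cong_0) (auto simp: set_pmf_eq pmf_pair)
    also have "\<dots> = measure_pmf.prob M {f. X' f} * measure_pmf.prob N {f. Y' f}"
      by (subst measure_pmf_prob_product) (auto simp: measure_Int_set_pmf)
    finally show ?thesis .
  qed
  have "measure_pmf.prob (Pi_pmf A d p) {f. X f} = measure_pmf.prob M {f. X f}"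
    using prod[where X' = X and Y' = "\<lambda>_. True", OF X] by simp
  moreover have "measure_pmf.prob (Pi_pmf A d p) {f. Y f} = measure_pmf.prob N {f. Y f}"
    using prod[where X' = "\<lambda>_. True" and Y' = Y, OF _ Y] by simp
  moreover have "measure_pmf.prob (Pi_pmf A d p) {f. X f \<and> Y f} =
      measure_pmf.prob M {f. X f} * measure_pmf.prob N {f. Y f}"
    by (rule prod[OF X Y])
  ultimately show ?thesis by simp
qed

locale coins =
  fixes A :: "'a set" and p :: real
  assumes finite_A: "finite A" and p01: "0 \<le> p" "p \<le> 1"
begin

definition coin_pmf :: "('a \<Rightarrow> bool) pmf" where
  "coin_pmf = Pi_pmf A False (\<lambda>_. bernoulli_pmf p)"

abbreviation \<P> :: "('a \<Rightarrow> bool) set \<Rightarrow> real" where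
  "\<P> \<equiv> measure_pmf.prob coin_pmf"

lemma prob_const:
  assumes "S \<subseteq> A"
  shows "\<P> {c. \<forall>e\<in>S. c e = b} = (if b then p else 1 - p) ^ card S"
proof -
  have "{c. \<forall>e\<in>S. c e = b} = Pi A (\<lambda>e. if e \<in> S then {b} else UNIV)"
    using assms by (auto simp: Pi_iff split: if_splits)
  then have "\<P> {c. \<forall>e\<in>S. c e = b} =
      (\<Prod>e\<in>A. measure_pmf.prob (bernoulli_pmf p) (if e \<in> S then {b} else UNIV))"
    unfolding coin_pmf_def using finite_A by (simp add: measure_Pi_pmf_Pi)
  also have "\<dots> = (\<Prod>e\<in>A. if e \<in> S then (if b then p else 1 - p) else 1)"
    using p01 by (intro prod.cong) (auto simp: measure_pmf_single)
  also have "\<dots> = (\<Prod>e\<in>A \<inter> S. (if b then p else 1 - p))"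
    using finite_A by (subst prod.inter_restrict) auto
  also have "\<dots> = (if b then p else 1 - p) ^ card S"
    using assms by (simp add: Int_absorb1)
  finally show ?thesis .
qed

lemma prob_indep:
  assumes "B \<subseteq> A"
    and "\<And>f g. (\<And>x. x \<in> B \<Longrightarrow> f x = g x) \<Longrightarrow> X f = X g"
    and "\<And>f g. (\<And>x. x \<notin> B \<Longrightarrow> f x = g x) \<Longrightarrow> Y f = Y g"
  shows "\<P> {c. X c \<and> Y c} = \<P> {c. X c} * \<P> {c. Y c}"
  unfolding coin_pmf_def using finite_A assms by (rule prob_Pi_pmf_indep)

lemma prob_mono: "(\<And>c. X c \<Longrightarrow> Y c) \<Longrightarrow> \<P> {c. X c} \<le> \<P> {c. Y c}"
  by (intro measure_pmf.finite_measure_mono) auto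

lemma prob_union_bound:
  assumes "finite I" "\<And>c. X c \<Longrightarrow> \<exists>i\<in>I. Y i c"
  shows "\<P> {c. X c} \<le> (\<Sum>i\<in>I. \<P> {c. Y i c})"
proof -
  have "\<P> {c. X c} \<le> \<P> (\<Union>i\<in>I. {c. Y i c})"
    using assms(2) by (intro measure_pmf.finite_measure_mono) auto
  also have "\<dots> \<le> (\<Sum>i\<in>I. \<P> {c. Y i c})"
    using assms(1) by (intro measure_pmf.finite_measure_subadditive_finite) auto
  finally show ?thesis .
qed

text \<open>Disjoint blocks of coins are independent, so they can be split off one at a
  time.\<close>

lemma prob_no_block:
  assumes "finite Z" "\<And>z. z \<in> Z \<Longrightarrow> F z \<subseteq> A" "\<And>z. z \<in> Z \<Longrightarrow> card (F z) = k"
    and "disjoint_family_on F Z"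
  shows "\<P> {c. \<forall>z\<in>Z. \<not> (\<forall>e\<in>F z. c e)} = (1 - p ^ k) ^ card Z"
  using assms
proof (induction Z rule: finite_induct)
  case empty
  then show ?case by simp
next
  case (insert z Z)
  have "\<P> {c. \<not> (\<forall>e\<in>F z. c e)} = 1 - \<P> {c. \<forall>e\<in>F z. c e}"
    by (subst measure_pmf.prob_compl[symmetric]) (auto intro!: arg_cong[of _ _ \<P>])
  also have "\<dots> = 1 - p ^ k"
    using prob_const[of "F z" True] insert.prems by simp
  finally have z: "\<P> {c. \<not> (\<forall>e\<in>F z. c e)} = 1 - p ^ k" .
  have "{c. \<forall>y\<in>insert z Z. \<not> (\<forall>e\<in>F y. c e)} = {c. \<not> (\<forall>e\<in>F z. c e) \<and> (\<forall>y\<in>Z. \<not> (\<forall>e\<in>F y. c e))}"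
    by auto
  also have "\<P> \<dots> = \<P> {c. \<not> (\<forall>e\<in>F z. c e)} * \<P> {c. \<forall>y\<in>Z. \<not> (\<forall>e\<in>F y. c e)}"
  proof (rule prob_indep[of "F z"])
    show "F z \<subseteq> A" using insert.prems by simp
    show "(\<not> (\<forall>e\<in>F z. f e)) = (\<not> (\<forall>e\<in>F z. g e))" if "\<And>x. x \<in> F z \<Longrightarrow> f x = g x"
      for f g :: "'a \<Rightarrow> bool"
      using that by auto
    show "(\<forall>y\<in>Z. \<not> (\<forall>e\<in>F y. f e)) = (\<forall>y\<in>Z. \<not> (\<forall>e\<in>F y. g e))" if fg: "\<And>x. x \<notin> F z \<Longrightarrow> f x = g x"
      for f g :: "'a \<Rightarrow> bool"
    proof -
      have "f e = g e" if "y \<in> Z" "e \<in> F y" for y e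
      proof (rule fg)
        have "F z \<inter> F y = {}"
          using insert.prems(3) insert.hyps that by (auto simp: disjoint_family_on_def)
        then show "e \<notin> F z" using that by blast
      qed
      then show ?thesis by auto
    qed
  qed
  also have "\<P> {c. \<forall>y\<in>Z. \<not> (\<forall>e\<in>F y. c e)} = (1 - p ^ k) ^ card Z"
    using insert.prems by (intro insert.IH) (auto simp: disjoint_family_on_def)
  finally show ?case using insert.hyps z by simp
qed

end

section \<open>Bad events in the random graph\<close>

locale random_graph = coins "nsets {1..n} 2" p for n :: nat and p :: real
begin

definition E :: "(nat set \<Rightarrow> bool) \<Rightarrow> nat set set" where
  "E c = {e \<in> nsets {1..n} 2. c e}"

lemma gnp_eq: "gnp n p = map_pmf (\<lambda>c. ({1..n}, E c)) coin_pmf"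
  by (simp only: gnp_def coin_pmf_def E_def)

lemma E_subset: "E c \<subseteq> nsets {1..n} 2"
  by (auto simp: E_def)

text \<open>The pairs joining \<open>S\<close> to distinct vertices outside \<open>S\<close> form
  disjoint blocks of size \<open>card S\<close>, so the vertices of \<open>Z\<close> fail
  independently.\<close>

lemma prob_no_common_nbr:
  assumes S: "S \<subseteq> {1..n}" "Z \<subseteq> {1..n} - S"
  shows "\<P> {c. Z \<inter> common_nbrs {1..n} (E c) S = {}} = (1 - p ^ card S) ^ card Z"
proof -
  have fin: "finite Z" "finite S" using S finite_subset by blast+
  define F where "F z = (\<lambda>v. {v, z}) ` S" for z
  have F: "F z \<subseteq> nsets {1..n} 2" "card (F z) = card S" if "z \<in> Z" for z
  proof -
    have "z \<in> {1..n}" "z \<notin> S" using that S by blast+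
    moreover have "v \<in> {1..n}" if "v \<in> S" for v using that S by blast
    ultimately show "F z \<subseteq> nsets {1..n} 2" by (auto simp: F_def)
    have "inj_on (\<lambda>v. {v, z}) S" by (auto simp: inj_on_def doubleton_eq_iff)
    then show "card (F z) = card S" by (simp add: F_def card_image)
  qed
  have "disjoint_family_on F Z"
    unfolding disjoint_family_on_def
  proof (intro ballI impI)
    fix y z assume yz: "y \<in> Z" "z \<in> Z" "y \<noteq> z"
    then have "y \<notin> S" "z \<notin> S" using S by blast+
    then show "F y \<inter> F z = {}" using yz by (auto simp: F_def doubleton_eq_iff)
  qed
  have "{c. Z \<inter> common_nbrs {1..n} (E c) S = {}} = {c. \<forall>z\<in>Z. \<not> (\<forall>e\<in>F z. c e)}"
  proof -
    have "z \<in> common_nbrs {1..n} (E c) S \<longleftrightarrow> (\<forall>e\<in>F z. c e)" if "z \<in> Z" for z c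
    proof -
      have "z \<in> {1..n}" using that S by blast
      moreover have "{v, z} \<in> nsets {1..n} 2" if "v \<in> S" for v
        using F(1)[OF \<open>z \<in> Z\<close>] that unfolding F_def by blast
      ultimately show ?thesis by (simp add: common_nbrs_def F_def E_def)
    qed
    then show ?thesis by blast
  qed
  then show ?thesis
    using prob_no_block[of Z F "card S"] F fin \<open>disjoint_family_on F Z\<close> by simp
qed

lemma prob_not_extendable_le:
  assumes "k \<le> n"
  shows "\<P> {c. \<not> extendable k {1..n} (E c)} \<le> real n ^ k * (1 - p ^ k) ^ (n - k)"
proof -
  have "\<P> {c. \<not> extendable k {1..n} (E c)} \<le>
      (\<Sum>S\<in>nsets {1..n} k. \<P> {c. ({1..n} - S) \<inter> common_nbrs {1..n} (E c) S = {}})"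
  proof (rule prob_union_bound)
    fix c assume "\<not> extendable k {1..n} (E c)"
    then obtain S where S: "S \<subseteq> {1..n}" "card S \<le> k" "common_nbrs {1..n} (E c) S = {}"
      by (auto simp: extendable_def)
    \<comment> \<open>Enlarging \<open>S\<close> to exactly \<open>k\<close> vertices only shrinks
      its common neighbourhood, so a union bound over \<open>k\<close>-sets suffices.\<close>
    obtain S' where S': "S \<subseteq> S'" "S' \<subseteq> {1..n}" "card S' = k"
      using exists_subset_between[OF S(2) _ S(1)] assms by auto
    have "common_nbrs {1..n} (E c) S' = {}" using S(3) common_nbrs_antimono[OF S'(1)] by blast
    then show "\<exists>S\<in>nsets {1..n} k. ({1..n} - S) \<inter> common_nbrs {1..n} (E c) S = {}"
      using S' finite_subset[OF S'(2)] by (intro bexI[of _ S']) (auto simp: nsets_def)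
  qed (simp add: finite_imp_finite_nsets)
  also have "\<dots> = (\<Sum>S\<in>nsets {1..n} k. (1 - p ^ k) ^ (n - k))"
  proof (rule sum.cong)
    fix S assume "S \<in> nsets {1..n} k"
    then have S: "S \<subseteq> {1..n}" "card S = k" "finite S" by (simp_all add: nsets_def)
    then have "card ({1..n} - S) = n - k" by (simp add: card_Diff_subset)
    then show "\<P> {c. ({1..n} - S) \<inter> common_nbrs {1..n} (E c) S = {}} = (1 - p ^ k) ^ (n - k)"
      by (simp only: prob_no_common_nbr[OF S(1) order_refl] S(2))
  qed simp
  also have "\<dots> = real (n choose k) * (1 - p ^ k) ^ (n - k)" by simp
  also have "\<dots> \<le> real n ^ k * (1 - p ^ k) ^ (n - k)"
    using binomial_le_pow[OF assms] p01
    by (intro mult_right_mono) (auto simp: power_le_one simp flip: of_nat_power)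
  finally show ?thesis .
qed

text \<open>Fewer than \<open>K\<close> common neighbours fit into some \<open>K\<close>-set
  \<open>Y\<close>, and then no vertex outside \<open>Y\<close> is one. The union bound runs over
  \<open>Y\<close>.\<close>

lemma prob_few_common_nbrs_le:
  assumes v: "v \<in> {1..n}" "w \<in> {1..n}" "v \<noteq> w" and K: "K + 2 \<le> n"
  shows "\<P> {c. card (common_nbrs {1..n} (E c) {v, w}) < K} \<le> real n ^ K * (1 - p\<^sup>2) ^ (n - 2 - K)"
proof -
  let ?V = "{1..n} - {v, w}"
  have cardV: "card ?V = n - 2" using v by (simp add: card_Diff_subset)
  have "\<P> {c. card (common_nbrs {1..n} (E c) {v, w}) < K} \<le>
      (\<Sum>Y\<in>nsets ?V K. \<P> {c. (?V - Y) \<inter> common_nbrs {1..n} (E c) {v, w} = {}})"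
  proof (rule prob_union_bound)
    fix c assume less: "card (common_nbrs {1..n} (E c) {v, w}) < K"
    let ?U = "common_nbrs {1..n} (E c) {v, w}"
    have "?U \<subseteq> ?V"
      using singleton_notin_edges[OF E_subset[of c]] by (auto simp: common_nbrs_def)
    moreover have "card ?U \<le> K" "K \<le> card ?V" using less K cardV by simp_all
    ultimately obtain Y where "?U \<subseteq> Y" "Y \<subseteq> ?V" "card Y = K"
      using exists_subset_between[of ?U K ?V] by blast
    then show "\<exists>Y\<in>nsets ?V K. (?V - Y) \<inter> ?U = {}"
      using finite_subset[of Y ?V] by (intro bexI[of _ Y]) (auto simp: nsets_def)
  qed (simp add: finite_imp_finite_nsets)
  also have "\<dots> = (\<Sum>Y\<in>nsets ?V K. (1 - p\<^sup>2) ^ (n - 2 - K))"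
  proof (rule sum.cong)
    fix Y assume "Y \<in> nsets ?V K"
    then have "Y \<subseteq> ?V" "card Y = K" "finite Y" by (auto simp: nsets_def)
    then have "card (?V - Y) = n - 2 - K" by (simp only: card_Diff_subset cardV)
    moreover have "card {v, w} = 2" using v by simp
    moreover have "{v, w} \<subseteq> {1..n}" "?V - Y \<subseteq> {1..n} - {v, w}" using v by auto
    ultimately show "\<P> {c. (?V - Y) \<inter> common_nbrs {1..n} (E c) {v, w} = {}} = (1 - p\<^sup>2) ^ (n - 2 - K)"
      by (simp only: prob_no_common_nbr)
  qed simp
  also have "\<dots> = real ((n - 2) choose K) * (1 - p\<^sup>2) ^ (n - 2 - K)"
    using cardV by simp
  also have "\<dots> \<le> real n ^ K * (1 - p\<^sup>2) ^ (n - 2 - K)"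
  proof (rule mult_right_mono)
    have "(n - 2) choose K \<le> (n - 2) ^ K" using K by (intro binomial_le_pow) simp
    also have "\<dots> \<le> n ^ K" by (intro power_mono) auto
    finally show "real ((n - 2) choose K) \<le> real n ^ K" by (simp flip: of_nat_power)
    show "0 \<le> (1 - p\<^sup>2) ^ (n - 2 - K)" using p01 by (simp add: power_le_one)
  qed
  finally show ?thesis .
qed

text \<open>One side of any cut of \<open>W\<close> has at least \<open>M\<close> vertices. With
  \<open>A\<close> the opposite side, the cut is empty with probability at most
  \<open>q ^ card A\<close>, and these powers summed over nonempty \<open>A\<close> give
  \<open>(1 + q) ^ card W - 1\<close>.\<close>

lemma prob_not_cut_connected_le:
  assumes W: "W \<subseteq> {1..n}" "2 * M \<le> card W"
  shows "\<P> {c. \<not> cut_connected (E c) W} \<le> (1 + (1 - p) ^ M) ^ n - 1"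
proof -
  define q where "q = (1 - p) ^ M"
  have q: "0 \<le> q" using p01 by (simp add: q_def)
  have finW: "finite W" using W finite_subset by blast
  define \<A> where "\<A> = {A \<in> Pow W - {{}}. M \<le> card (W - A)}"
  define cut where "cut A = (\<lambda>(a, b). {a, b}) ` (A \<times> (W - A))" for A
  have card_cut: "card (cut A) = card A * card (W - A)" if "A \<subseteq> W" for A
    unfolding cut_def by (subst card_image)
      (auto simp: inj_on_def doubleton_eq_iff card_cartesian_product)
  have "\<P> {c. \<not> cut_connected (E c) W} \<le> (\<Sum>A\<in>\<A>. \<P> {c. \<forall>e\<in>cut A. c e = False})"
  proof (rule prob_union_bound)
    show "finite \<A>" using finW by (simp add: \<A>_def)
    fix c assume "\<not> cut_connected (E c) W"
    then obtain A where A: "A \<subseteq> W" "A \<noteq> {}" "A \<noteq> W" "\<And>a b. a \<in> A \<Longrightarrow> b \<in> W - A \<Longrightarrow> {a, b} \<notin> E c"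
      unfolding cut_connected_def by blast
    have not: "\<not> c {a, b}" if "a \<in> A" "b \<in> W - A" for a b
      using A(4)[OF that] that A(1) W(1) by (auto simp: E_def)
    have "card A + card (W - A) = card W"
      using A(1) finW card_mono[OF finW A(1)] by (simp add: card_Diff_subset finite_subset)
    then consider "M \<le> card (W - A)" | "M \<le> card A" using W(2) by linarith
    then show "\<exists>A\<in>\<A>. \<forall>e\<in>cut A. c e = False"
    proof cases
      case 1
      then show ?thesis using A not by (intro bexI[of _ A]) (auto simp: \<A>_def cut_def)
    next
      case 2
      have WA: "W - (W - A) = A" using A(1) by blast
      have "\<not> c {b, a}" if "a \<in> A" "b \<in> W - A" for a b
        using not[OF that] by (simp add: insert_commute)
      then have "\<forall>e\<in>cut (W - A). c e = False" unfolding cut_def WA by auto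
      moreover have "W - A \<in> \<A>" unfolding \<A>_def using A 2 WA by auto
      ultimately show ?thesis by blast
    qed
  qed
  also have "\<dots> \<le> (\<Sum>A\<in>\<A>. q ^ card A)"
  proof (rule sum_mono)
    fix A assume A: "A \<in> \<A>"
    have "cut A \<subseteq> nsets W 2" using A by (auto simp: \<A>_def cut_def)
    then have "cut A \<subseteq> nsets {1..n} 2" using nsets_mono[OF W(1), of 2] by blast
    then have "\<P> {c. \<forall>e\<in>cut A. c e = False} = (1 - p) ^ (card A * card (W - A))"
      using prob_const[of "cut A" False] card_cut[of A] A by (simp add: \<A>_def)
    also have "\<dots> \<le> (1 - p) ^ (M * card A)"
      using A p01 by (intro power_decreasing) (auto simp: \<A>_def mult.commute)
    also have "\<dots> = q ^ card A" by (simp add: q_def power_mult)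
    finally show "\<P> {c. \<forall>e\<in>cut A. c e = False} \<le> q ^ card A" .
  qed
  also have "\<dots> \<le> (\<Sum>A\<in>Pow W - {{}}. q ^ card A)"
    using finW q by (intro sum_mono2) (auto simp: \<A>_def)
  also have "\<dots> = (\<Sum>A\<in>Pow W. q ^ card A) - 1"
    using finW by (subst sum_diff) auto
  also have "(\<Sum>A\<in>Pow W. q ^ card A) = (1 + q) ^ card W"
    using prod_add[OF finW, of "\<lambda>_. q" "\<lambda>_. 1"] by (simp add: add.commute)
  also have "(1 + q) ^ card W - 1 \<le> (1 + q) ^ n - 1"
    using card_mono[OF _ W(1)] q by (intro diff_right_mono power_increasing) auto
  finally show ?thesis by (simp add: q_def)
qed

text \<open>
  The common neighbourhood \<open>W\<close> of \<open>v\<close> and \<open>w\<close> is determined by the edges at \<open>v\<close> and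
  \<open>w\<close>, and so is independent of the edges inside \<open>W\<close>.
\<close>

lemma prob_common_nbrs_not_cut_connected_le:
  assumes v: "v \<in> {1..n}" "w \<in> {1..n}" "v \<noteq> w" and K: "2 * M + 2 \<le> n"
  shows "\<P> {c. \<not> cut_connected (E c) (common_nbrs {1..n} (E c) {v, w})} \<le>
    real n ^ (2 * M) * (1 - p\<^sup>2) ^ (n - 2 - 2 * M) + ((1 + (1 - p) ^ M) ^ n - 1)"
proof -
  define U where "U c = common_nbrs {1..n} (E c) {v, w}" for c
  define \<delta> where "\<delta> = (1 + (1 - p) ^ M) ^ n - 1"
  define V where "V = {1..n} - {v, w}"
  define \<W> where "\<W> = {W. W \<subseteq> V \<and> 2 * M \<le> card W}"
  \<comment> \<open>The pairs meeting \<open>{v, w}\<close>: they determine \<open>U c\<close>,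
    while no pair inside a set \<open>W\<close> from \<open>\<W>\<close> belongs to
    \<open>B\<close>.\<close>
  define B where "B = {e \<in> nsets {1..n} 2. e \<inter> {v, w} \<noteq> {}}"
  have \<delta>: "0 \<le> \<delta>" using p01 by (simp add: \<delta>_def)
  have UV: "U c \<subseteq> V" for c
    using singleton_notin_edges[OF E_subset[of c]] by (auto simp: U_def V_def common_nbrs_def)
  have fin\<W>: "finite \<W>" by (simp add: \<W>_def V_def)
  have "\<P> {c. \<not> cut_connected (E c) (U c)} \<le>
      \<P> {c. card (U c) < 2 * M} + \<P> {c. \<exists>W\<in>\<W>. U c = W \<and> \<not> cut_connected (E c) W}"
  proof -
    have "{c. \<not> cut_connected (E c) (U c)} \<subseteq>
        {c. card (U c) < 2 * M} \<union> {c. \<exists>W\<in>\<W>. U c = W \<and> \<not> cut_connected (E c) W}"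
      using UV by (auto simp: \<W>_def)
    then have "\<P> {c. \<not> cut_connected (E c) (U c)} \<le>
        \<P> ({c. card (U c) < 2 * M} \<union> {c. \<exists>W\<in>\<W>. U c = W \<and> \<not> cut_connected (E c) W})"
      by (intro measure_pmf.finite_measure_mono) auto
    also have "\<dots> \<le> \<P> {c. card (U c) < 2 * M} + \<P> {c. \<exists>W\<in>\<W>. U c = W \<and> \<not> cut_connected (E c) W}"
      by (intro measure_Un_le) auto
    finally show ?thesis .
  qed
  also have "\<P> {c. card (U c) < 2 * M} \<le> real n ^ (2 * M) * (1 - p\<^sup>2) ^ (n - 2 - 2 * M)"
    unfolding U_def by (rule prob_few_common_nbrs_le) (use v K in auto)
  also have "\<P> {c. \<exists>W\<in>\<W>. U c = W \<and> \<not> cut_connected (E c) W} \<le>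
      (\<Sum>W\<in>\<W>. \<P> {c. U c = W \<and> \<not> cut_connected (E c) W})"
    by (rule prob_union_bound[OF fin\<W>])
  also have "\<dots> \<le> (\<Sum>W\<in>\<W>. \<P> {c. U c = W} * \<delta>)"
  proof (rule sum_mono)
    fix W assume W: "W \<in> \<W>"
    have "\<P> {c. U c = W \<and> \<not> cut_connected (E c) W} = \<P> {c. U c = W} * \<P> {c. \<not> cut_connected (E c) W}"
    proof (rule prob_indep[of B])
      show "B \<subseteq> nsets {1..n} 2" by (auto simp: B_def)
      show "(U f = W) = (U g = W)" if fg: "\<And>e. e \<in> B \<Longrightarrow> f e = g e" for f g
      proof -
        have "{u, x} \<in> E f \<longleftrightarrow> {u, x} \<in> E g" if "u \<in> {v, w}" for u x
          using fg[of "{u, x}"] that by (auto simp: E_def B_def)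
        then have "U f = U g" by (simp add: U_def common_nbrs_def)
        then show ?thesis by simp
      qed
      show "(\<not> cut_connected (E f) W) = (\<not> cut_connected (E g) W)"
        if fg: "\<And>e. e \<notin> B \<Longrightarrow> f e = g e" for f g
      proof -
        have "{a, b} \<in> E f \<longleftrightarrow> {a, b} \<in> E g" if "a \<in> W" "b \<in> W" for a b
        proof -
          have "{a, b} \<notin> B" using that W by (auto simp: B_def \<W>_def V_def)
          then show ?thesis using fg by (simp add: E_def)
        qed
        then show ?thesis using cut_connected_cong[of W "E f" "E g"] by simp
      qed
    qed
    also have "\<dots> \<le> \<P> {c. U c = W} * \<delta>"
      using prob_not_cut_connected_le[of W M] W
      by (intro mult_left_mono) (auto simp: \<delta>_def \<W>_def V_def)
    finally show "\<P> {c. U c = W \<and> \<not> cut_connected (E c) W} \<le> \<P> {c. U c = W} * \<delta>" .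
  qed
  also have "\<dots> = (\<Sum>W\<in>\<W>. \<P> {c. U c = W}) * \<delta>" by (simp add: sum_distrib_right)
  \<comment> \<open>The events \<open>U c = W\<close> are disjoint for different \<open>W\<close>,
    so their probabilities add up to at most 1.\<close>
  also have "(\<Sum>W\<in>\<W>. \<P> {c. U c = W}) = \<P> (\<Union>W\<in>\<W>. {c. U c = W})"
    by (rule measure_pmf.finite_measure_finite_Union[symmetric])
      (auto simp: fin\<W> disjoint_family_on_def)
  also have "\<dots> * \<delta> \<le> 1 * \<delta>" using \<delta> by (intro mult_right_mono) auto
  finally show ?thesis by (simp add: U_def \<delta>_def)
qed

end

section \<open>Estimates at the threshold\<close>

lemma one_minus_power_le_exp:
  fixes x :: real
  assumes "x \<le> 1"
  shows "(1 - x) ^ m \<le> exp (- (real m * x))"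
proof -
  have "(1 - x) ^ m \<le> exp (- x) ^ m"
    using assms exp_ge_add_one_self[of "- x"] by (intro power_mono) auto
  also have "\<dots> = exp (- (real m * x))"
    by (simp flip: exp_of_nat_mult)
  finally show ?thesis .
qed

text \<open>The threshold gives the power \<open>k\<close> of the logarithm; it is lowered to 3,
  which still outweighs the entropy term \<open>k * ln n\<close> and makes the later bounds
  uniform.\<close>

lemma power_ge_of_threshold:
  fixes p :: real
  assumes "k \<ge> 3" "n \<ge> 1" "ln (real n) \<ge> 1" "p \<ge> real n powr (- 1 / real k) * ln (real n)"
  shows "p ^ k \<ge> ln (real n) ^ 3 / real n"
proof -
  have "(real n powr (- 1 / real k)) ^ k = real n powr (- 1)"
    using assms by (simp add: powr_powr flip: powr_realpow)
  also have "\<dots> = 1 / real n" using assms by (simp add: powr_minus_divide)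
  finally have n: "(real n powr (- 1 / real k)) ^ k = 1 / real n" .
  have "ln (real n) ^ 3 / real n \<le> ln (real n) ^ k / real n"
    using assms by (intro divide_right_mono power_increasing) auto
  also have "\<dots> = (real n powr (- 1 / real k) * ln (real n)) ^ k"
    by (simp only: power_mult_distrib n) simp
  also have "\<dots> \<le> p ^ k" using assms by (intro power_mono) auto
  finally show ?thesis .
qed

lemma power_eq_exp_ln: "n \<ge> 1 \<Longrightarrow> real n ^ k = exp (real k * ln (real n))"
  by (simp add: exp_of_nat_mult)

text \<open>At least half of the vertices remain outside a \<open>k\<close>-set since
  \<open>n \<ge> 2 * k\<close>, whence the factor 1/2 in the exponent.\<close>

lemma not_extendable_bound:
  fixes p :: real
  assumes "k \<ge> 3" "n \<ge> 2 * k" "ln (real n) \<ge> 1" "p \<ge> real n powr (- 1 / real k) * ln (real n)"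
    and "0 \<le> p" "p \<le> 1"
  shows "real n ^ k * (1 - p ^ k) ^ (n - k) \<le> exp (real k * ln (real n) - ln (real n) ^ 3 / 2)"
proof -
  have n: "n \<ge> 1" using assms by simp
  have "ln (real n) ^ 3 / 2 = (real n / 2) * (ln (real n) ^ 3 / real n)" using n by simp
  also have "\<dots> \<le> real (n - k) * p ^ k"
    using power_ge_of_threshold[of k n p] assms n by (intro mult_mono) auto
  finally have *: "ln (real n) ^ 3 / 2 \<le> real (n - k) * p ^ k" .
  have "real n ^ k * (1 - p ^ k) ^ (n - k) \<le> exp (real k * ln (real n)) * exp (- (real (n - k) * p ^ k))"
    unfolding power_eq_exp_ln[OF n]
    using assms by (intro mult_left_mono one_minus_power_le_exp power_le_one) auto
  also have "\<dots> \<le> exp (real k * ln (real n) - ln (real n) ^ 3 / 2)"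
    using * by (simp flip: exp_add)
  finally show ?thesis .
qed

text \<open>With \<open>t = 1 / p\<close>, the choice of \<open>2 * M\<close> vertices costs about
  \<open>6 * L^2 * t\<close> in the exponent, while \<open>p ^ 3 \<ge> L ^ 3 / n\<close> makes
  \<open>n * p^2\<close> at least \<open>L ^ 3 * t\<close>. The leading factor \<open>n\<close> pays
  for a union bound over vertices.\<close>

lemma few_common_nbrs_bound:
  fixes p :: real
  assumes L: "ln (real n) \<ge> 20" and p: "p \<ge> real n powr (- 1 / 3) * ln (real n)" "0 < p" "p \<le> 1"
    and M: "real M \<le> 3 * ln (real n) / p + 1" "4 * M + 4 \<le> n"
  shows "real n * (real n ^ (2 * M) * (1 - p\<^sup>2) ^ (n - 2 - 2 * M)) \<le> exp (- ln (real n))"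
proof -
  define L where "L = ln (real n)"
  define t where "t = 1 / p"
  have n: "n \<ge> 1" using M by simp
  have t: "1 \<le> t" using p by (simp add: t_def)
  have "L ^ 3 / real n \<le> p ^ 3"
    using power_ge_of_threshold[of 3 n p] L p n by (simp add: L_def)
  then have "L ^ 3 * t \<le> real n * p\<^sup>2"
    using n p by (simp add: t_def field_simps power3_eq_cube power2_eq_square)
  moreover have "real n / 2 * p\<^sup>2 \<le> real (n - 2 - 2 * M) * p\<^sup>2"
    using M by (intro mult_right_mono) auto
  ultimately have *: "L ^ 3 * t / 2 \<le> real (n - 2 - 2 * M) * p\<^sup>2" by linarith
  have "real (2 * M) * L \<le> (6 * L * t + 2) * L"
    using M L by (intro mult_right_mono) (auto simp: L_def t_def)
  then have 1: "L + real (2 * M) * L - L ^ 3 * t / 2 \<le> L + (6 * L * t + 2) * L - L ^ 3 * t / 2"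
    by linarith
  \<comment> \<open>By \<open>L \<ge> 20\<close> the gain \<open>L ^ 3 * t / 2\<close> is at least
    \<open>10 * L^2 * t\<close>; after paying \<open>6 * L^2 * t\<close>, the rest exceeds
    \<open>3 * L\<close> by at least \<open>L\<close>.\<close>
  have "20 * (L\<^sup>2 * t) \<le> L * (L\<^sup>2 * t)" using L t by (intro mult_right_mono) (auto simp: L_def)
  moreover have "L * 1 \<le> L * (L * t)"
    using L t mult_mono[of 1 L 1 t] by (intro mult_left_mono) (auto simp: L_def)
  ultimately have 2: "L + (6 * L * t + 2) * L - L ^ 3 * t / 2 \<le> - L"
    by (simp add: algebra_simps power2_eq_square power3_eq_cube)
  have "p\<^sup>2 \<le> 1" using p by (intro power_le_one) auto
  have "real n * (real n ^ (2 * M) * (1 - p\<^sup>2) ^ (n - 2 - 2 * M)) \<le>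
      exp L * (exp (real (2 * M) * L) * exp (- (real (n - 2 - 2 * M) * p\<^sup>2)))"
    unfolding power_eq_exp_ln[OF n] L_def
    using n \<open>p\<^sup>2 \<le> 1\<close> by (intro mult_mono one_minus_power_le_exp) auto
  also have "\<dots> = exp (L + real (2 * M) * L - real (n - 2 - 2 * M) * p\<^sup>2)"
    by (simp add: exp_add exp_diff exp_minus field_simps)
  also have "\<dots> \<le> exp (- L)" using * 1 2 by simp
  finally show ?thesis by (simp add: L_def)
qed

text \<open>Since \<open>M * p \<ge> 3 * ln n\<close>, a vertex misses \<open>M\<close> given others
  with probability at most n^(-3). Hence the power is at most exp(n^(-2)), and even \<open>n\<close>
  times the excess over 1 tends to zero.\<close>

lemma not_cut_connected_bound:
  fixes p :: real
  assumes "n \<ge> 1" "0 < p" "p \<le> 1" "real M \<ge> 3 * ln (real n) / p"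
  shows "real n * ((1 + (1 - p) ^ M) ^ n - 1) \<le> real n * (exp (exp (- (2 * ln (real n)))) - 1)"
proof -
  have "(1 - p) ^ M \<le> exp (- (real M * p))" using assms by (intro one_minus_power_le_exp)
  also have "\<dots> \<le> exp (- (3 * ln (real n)))"
    using assms by (simp add: field_simps)
  finally have q: "(1 - p) ^ M \<le> exp (- (3 * ln (real n)))" .
  have "1 + (1 - p) ^ M \<le> exp ((1 - p) ^ M)" by (rule exp_ge_add_one_self)
  also have "\<dots> \<le> exp (exp (- (3 * ln (real n))))" using q by simp
  finally have "(1 + (1 - p) ^ M) ^ n \<le> exp (exp (- (3 * ln (real n)))) ^ n"
    using assms by (intro power_mono) auto
  also have "\<dots> = exp (real n * exp (- (3 * ln (real n))))"
    by (simp flip: exp_of_nat_mult)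
  also have "real n * exp (- (3 * ln (real n))) = exp (ln (real n)) * exp (- (3 * ln (real n)))"
    using assms by simp
  also have "\<dots> = exp (- (2 * ln (real n)))"
    by (simp flip: exp_add)
  finally show ?thesis using assms by (intro mult_left_mono) auto
qed

section \<open>The failure probability and its limit\<close>

context random_graph
begin

lemma prob_not_property_A_le:
  assumes "s \<ge> 4" "2 * (2 * s - 3) \<le> n"
  shows "\<P> {c. \<not> property_A s ({1..n}, E c)} \<le> \<P> {c. \<not> extendable (2 * s - 3) {1..n} (E c)}"
proof (rule prob_mono, erule contrapos_nn)
  fix c assume ext: "extendable (2 * s - 3) {1..n} (E c)"
  \<comment> \<open>\<open>s - 2 + 3 \<le> 2 * s - 3\<close> is where \<open>s \<ge> 4\<close>
    enters.\<close>
  have "extendable (s - 2 + 3) {1..n} (E c)" "extendable (s - 2 + 1) {1..n} (E c)"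
    by (rule extendable_mono[OF ext], use assms in simp)+
  then show "property_A s ({1..n}, E c)"
    using assms
    by (intro property_A_if_percolating[where d = "s - 2"] has_small_percolating_set_extendable E_subset) auto
qed

text \<open>Vertex 1 is fixed as the root, so connectedness is needed only for the common
  neighbourhoods of 1 and \<open>v\<close>, at most \<open>n\<close> of them.\<close>

lemma prob_not_property_A_3_le:
  assumes "2 * M + 2 \<le> n"
  shows "\<P> {c. \<not> property_A 3 ({1..n}, E c)} \<le> \<P> {c. \<not> extendable 3 {1..n} (E c)} +
    real n * (real n ^ (2 * M) * (1 - p\<^sup>2) ^ (n - 2 - 2 * M) + ((1 + (1 - p) ^ M) ^ n - 1))"
    (is "_ \<le> _ + real n * ?b")
proof -
  let ?disc = "\<lambda>v c. \<not> cut_connected (E c) (common_nbrs {1..n} (E c) {1, v})"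
  have det: "property_A 3 ({1..n}, E c)"
    if ext: "extendable 3 {1..n} (E c)" and conn: "\<forall>v\<in>{1..n} - {1}. \<not> ?disc v c" for c
  proof (rule property_A_if_percolating[where d = 1])
    show "has_small_percolating_set 1 {1..n} (E c)"
      by (rule has_small_percolating_set_1[of _ _ 1]) (use ext conn E_subset assms in auto)
    show "extendable (1 + 1) {1..n} (E c)" by (rule extendable_mono[OF ext]) simp
  qed (use assms E_subset in auto)
  have b: "0 \<le> ?b" using p01 by (simp add: power_le_one)
  have "\<P> {c. \<not> property_A 3 ({1..n}, E c)} \<le>
      \<P> ({c. \<not> extendable 3 {1..n} (E c)} \<union> {c. \<exists>v\<in>{1..n} - {1}. ?disc v c})"
    using det by (intro measure_pmf.finite_measure_mono) auto
  also have "\<dots> \<le> \<P> {c. \<not> extendable 3 {1..n} (E c)} + \<P> {c. \<exists>v\<in>{1..n} - {1}. ?disc v c}"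
    by (intro measure_Un_le) auto
  also have "\<P> {c. \<exists>v\<in>{1..n} - {1}. ?disc v c} \<le> (\<Sum>v\<in>{1..n} - {1}. \<P> {c. ?disc v c})"
    by (rule prob_union_bound) auto
  also have "\<dots> \<le> (\<Sum>v\<in>{1..n} - {1}. ?b)"
    using assms by (intro sum_mono prob_common_nbrs_not_cut_connected_le) auto
  also have "\<dots> \<le> (\<Sum>v\<in>{1..n}. ?b)" using b by (intro sum_mono2) auto
  finally show ?thesis by simp
qed

end

lemma prob_property_A_ge:
  fixes p :: real
  assumes s: "s \<ge> 3" and p01: "0 \<le> p" "p \<le> 1"
    and p: "p \<ge> real n powr (- 1 / (2 * real s - 3)) * ln (real n)"
    and n: "n \<ge> 2 * (2 * s - 3)" "ln (real n) \<ge> 20" "12 * real n powr (1 / 3) + 8 \<le> real n"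
  shows "measure_pmf.prob (gnp n p) {G. property_A s G} \<ge>
    1 - (exp ((2 * real s - 3) * ln (real n) - ln (real n) ^ 3 / 2) +
      (exp (- ln (real n)) + real n * (exp (exp (- (2 * ln (real n)))) - 1)))"
    (is "_ \<ge> 1 - (?e1 + (?e2 + ?e3))")
proof -
  interpret random_graph n p
    by unfold_locales (use p01 in \<open>auto intro: finite_imp_finite_nsets\<close>)
  have k: "real (2 * s - 3) = 2 * real s - 3" using s by simp
  have "\<P> {c. \<not> extendable (2 * s - 3) {1..n} (E c)} \<le>
      real n ^ (2 * s - 3) * (1 - p ^ (2 * s - 3)) ^ (n - (2 * s - 3))"
    using n by (intro prob_not_extendable_le) auto
  also have "\<dots> \<le> ?e1"
    using not_extendable_bound[of "2 * s - 3" n p] s p p01 n unfolding k by simp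
  finally have e1: "\<P> {c. \<not> extendable (2 * s - 3) {1..n} (E c)} \<le> ?e1" .
  have e23: "0 \<le> ?e2 + ?e3" by simp
  have "\<P> {c. \<not> property_A s ({1..n}, E c)} \<le> ?e1 + (?e2 + ?e3)"
  proof (cases "s = 3")
    case False
    then show ?thesis using prob_not_property_A_le[of s] e1 e23 s n by linarith
  next
    case True
    have p3: "p \<ge> real n powr (- 1 / 3) * ln (real n)" using p True by simp
    have "0 < real n powr (- 1 / 3) * ln (real n)" using n s by simp
    then have "0 < p" using p3 by linarith
    \<comment> \<open>Large enough that \<open>M * p \<ge> 3 * ln n\<close> makes empty cuts
      unlikely, and no larger than rounding requires, so that \<open>2 * M\<close> common neighbours
      are still likely to exist.\<close>
    define M where "M = nat \<lceil>3 * ln (real n) / p\<rceil>"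
    have x: "0 \<le> 3 * ln (real n) / p" using n \<open>0 < p\<close> by simp
    then have M: "3 * ln (real n) / p \<le> real M" "real M \<le> 3 * ln (real n) / p + 1"
      unfolding M_def by linarith+
    \<comment> \<open>The threshold bounds \<open>ln n / p\<close> by n^(1/3), so
      \<open>4 * M + 4\<close> is at most 12 n^(1/3) + 8, the quantity in the third assumption on
      \<open>n\<close>.\<close>
    have "ln (real n) = real n powr (1 / 3) * (real n powr (- 1 / 3) * ln (real n))"
      using n s by (simp flip: powr_add mult.assoc)
    also have "\<dots> \<le> real n powr (1 / 3) * p" using p3 by (intro mult_left_mono) auto
    finally have "ln (real n) / p \<le> real n powr (1 / 3)"
      using \<open>0 < p\<close> by (simp add: field_simps)
    then have "real (4 * M + 4) \<le> real n" using M(2) n(3) by simp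
    then have M4: "4 * M + 4 \<le> n" by linarith
    have "\<P> {c. \<not> property_A 3 ({1..n}, E c)} \<le> \<P> {c. \<not> extendable 3 {1..n} (E c)} +
      real n * (real n ^ (2 * M) * (1 - p\<^sup>2) ^ (n - 2 - 2 * M) + ((1 + (1 - p) ^ M) ^ n - 1))"
      using M4 by (intro prob_not_property_A_3_le) simp
    also have "\<dots> \<le> ?e1 + (?e2 + ?e3)"
      unfolding distrib_left
    proof (intro add_mono)
      show "\<P> {c. \<not> extendable 3 {1..n} (E c)} \<le> ?e1" using e1 True by simp
      show "real n * (real n ^ (2 * M) * (1 - p\<^sup>2) ^ (n - 2 - 2 * M)) \<le> ?e2"
        using few_common_nbrs_bound[OF n(2) p3 \<open>0 < p\<close> p01(2) M(2) M4] .
      show "real n * ((1 + (1 - p) ^ M) ^ n - 1) \<le> ?e3"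
        using not_cut_connected_bound[OF _ \<open>0 < p\<close> p01(2) M(1)] M4 by simp
    qed
    finally show ?thesis using True by simp
  qed
  moreover have "measure_pmf.prob (gnp n p) {G. property_A s G} = \<P> {c. property_A s ({1..n}, E c)}"
    unfolding gnp_eq by (simp add: vimage_def)
  moreover have "\<P> {c. property_A s ({1..n}, E c)} = 1 - \<P> {c. \<not> property_A s ({1..n}, E c)}"
  proof -
    have "\<P> (UNIV - X) = 1 - \<P> X" for X
      using measure_pmf.prob_compl[of X coin_pmf] by simp
    from this[of "{c. \<not> property_A s ({1..n}, E c)}"] show ?thesis
      by (simp only: Diff_eq Compl_eq mem_Collect_eq not_not Int_UNIV_left)
  qed
  ultimately show ?thesis by simp
qed

theorem theorem4p4:
  fixes s :: nat and p :: "nat \<Rightarrow> real"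
  assumes "s \<ge> 3"
    and "\<forall>n. 0 \<le> p n \<and> p n \<le> 1"
    and "\<forall>\<^sub>F n in sequentially. p n \<ge> real n powr (- 1 / (2 * real s - 3)) * ln (real n)"
  shows "(\<lambda>n. measure_pmf.prob (gnp n (p n)) {G. property_A s G}) \<longlonglongrightarrow> 1"
proof (rule tendsto_sandwich)
  \<comment> \<open>The error vanishes: the cube of the logarithm dominates \<open>k * ln n\<close>,
    and \<open>n * (exp (exp (- (2 * ln n))) - 1)\<close> is asymptotically 1/n.\<close>
  define k where "k = 2 * real s - 3"
  show "(\<lambda>n. 1 - (exp (k * ln (real n) - ln (real n) ^ 3 / 2) +
      (exp (- ln (real n)) + real n * (exp (exp (- (2 * ln (real n)))) - 1)))) \<longlonglongrightarrow> 1"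
    by real_asymp
  have "\<forall>\<^sub>F n in sequentially. n \<ge> 2 * (2 * s - 3)" by (rule eventually_ge_at_top)
  moreover have "\<forall>\<^sub>F n in sequentially. ln (real n) \<ge> 20" by real_asymp
  moreover have "\<forall>\<^sub>F n in sequentially. 12 * real n powr (1 / 3) + 8 \<le> real n" by real_asymp
  ultimately show "\<forall>\<^sub>F n in sequentially. 1 - (exp (k * ln (real n) - ln (real n) ^ 3 / 2) +
      (exp (- ln (real n)) + real n * (exp (exp (- (2 * ln (real n)))) - 1)))
      \<le> measure_pmf.prob (gnp n (p n)) {G. property_A s G}"
    using assms(3)
  proof eventually_elim
    case (elim n)
    then show ?case unfolding k_def
      using prob_property_A_ge[of s "p n" n] assms(1,2) by simp
  qed
  show "\<forall>\<^sub>F n in sequentially. measure_pmf.prob (gnp n (p n)) {G. property_A s G} \<le> 1"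
    by (rule always_eventually) simp
qed (rule tendsto_const)

end
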